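(* Fix $\beta>0$, $\varepsilon\in(0,1/2]$, and let $(G_n)_{n\ge0}$ be the DRGVR with parameters $\beta,\varepsilon$, with its directed version $\vec G_n$. Write $V_n=\{v_1<\dots<v_{|V_n|}\}$ and let $d_n^-(v_i)$ be the out-degree of $v_i$ in $\vec G_n$, i.e. the number of neighbours of $v_i$ in $\{v_1,\dots,v_{i-1}\}$. Fix $L\in\mathbb N$ and an $L$-Lipschitz function $f$ defined on the set of finite directed graphs. Then, for every $t\ge0$, (i) $$\mathbb P\Big(\Big|f(\vec G_n)-\mathbb E\big[f(\vec G_n)\mid|V_n|,(d_n^-(v_i))_{i=1}^{|V_n|}\big]\Big|\ge t\ \Big|\ |V_n|,(d_n^-(v_i))_{i=1}^{|V_n|}\Big)\le2\exp\Big(-\frac{t^2}{8|E_n|L^2}\Big);$$ (ii) $$\mathbb P\Big(\Big|f(\vec G_n)-\mathbb E\big[f(\vec G_n)\mid(V_i)_{i=1}^n,|E_n|\big]\Big|\ge t\ \Big|\ (V_i)_{i=1}^n,|E_n|\Big)\le2\exp\Big(-\frac{t^2}{8|E_n|L^2}\Big).$$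
   Context: **DRGVR (Dynamic Random Graph with Vertex Removal).** Let $\beta>0$, $\varepsilon\in(0,1/2]$, $p=\tfrac12+\varepsilon$, and let $(\xi_n)_{n\ge1}$ be i.i.d. Bernoulli($p$). $G_0$ is the empty graph. For $n\ge1$, $G_n=(V_n,E_n)$ is built from $G_{n-1}=(V_{n-1},E_{n-1})$: if $\xi_n=1$, then $V_n=V_{n-1}\cup\{n\}$ and $E_n$ is obtained from $E_{n-1}$ by adding each edge $\{i,n\}$, $i\in V_{n-1}$, independently with probability $\min\{\beta/|V_{n-1}|,1\}$ (no edge is added if $V_{n-1}=\emptyset$); if $\xi_n=0$, a uniformly random vertex of $V_{n-1}$ (if any) is removed together with all its incident edges. $\vec G_n$ is $G_n$ with each edge oriented from the later-born endpoint (larger label) to the earlier-born endpoint. In (i), $\vec G_n$ is viewed as a directed graph on $\{1,\dots,|V_n|\}$ by identifying $v_i$ with $i$. A real-valued function $f$ on the set of finite directed graphs is **$L$-Lipschitz** if $|f(H_1)-f(H_2)|\le L$ for any two directed graphs $H_1,H_2$ with $|E(H_1)\setminus E(H_2)|+|E(H_2)\setminus E(H_1)|\le1$. *)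

theory Defs
  imports "HOL-Probability.Probability" "Graph_Theory.Pair_Digraph"
begin

text \<open>An undirected graph on natural-number labels: a vertex set together with a set of
  two-element edges.\<close>

type_synonym ugraph = "nat set \<times> nat set set"

abbreviation vertices :: "ugraph \<Rightarrow> nat set" where
  "vertices g \<equiv> fst g"

abbreviation edges :: "ugraph \<Rightarrow> nat set set" where
  "edges g \<equiv> snd g"

text \<open>The product distribution \<^const>\<open>Pi_pmf\<close> makes the decisions \<open>a i\<close>, for \<open>i\<close> in the old
  vertex set, independent.\<close>

definition add_vertex :: "real \<Rightarrow> nat \<Rightarrow> ugraph \<Rightarrow> ugraph pmf" where
  "add_vertex \<beta> n g =
     map_pmf (\<lambda>a. (vertices g \<union> {n}, edges g \<union> {{i, n} | i. i \<in> vertices g \<and> a i}))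
       (Pi_pmf (vertices g) False
          (\<lambda>_. bernoulli_pmf (min (\<beta> / real (card (vertices g))) 1)))"

definition remove_vertex :: "ugraph \<Rightarrow> ugraph pmf" where
  "remove_vertex g =
     (if vertices g = {} then return_pmf g
      else map_pmf (\<lambda>v. (vertices g - {v}, {e \<in> edges g. v \<notin> e})) (pmf_of_set (vertices g)))"

definition drgvr_step :: "real \<Rightarrow> real \<Rightarrow> nat \<Rightarrow> ugraph \<Rightarrow> ugraph pmf" where
  "drgvr_step \<beta> \<epsilon> n g =
     bind_pmf (bernoulli_pmf (1/2 + \<epsilon>)) (\<lambda>\<xi>. if \<xi> then add_vertex \<beta> n g else remove_vertex g)"

text \<open>The joint law of \<open>[G\<^sub>0, \<dots>, G\<^sub>n]\<close>. Each step draws a fresh \<open>\<xi>\<close>, independently of the past.\<close>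

primrec drgvr_history :: "real \<Rightarrow> real \<Rightarrow> nat \<Rightarrow> ugraph list pmf" where
  "drgvr_history \<beta> \<epsilon> 0 = return_pmf [({}, {})]"
| "drgvr_history \<beta> \<epsilon> (Suc n) =
     bind_pmf (drgvr_history \<beta> \<epsilon> n)
       (\<lambda>gs. map_pmf (\<lambda>g. gs @ [g]) (drgvr_step \<beta> \<epsilon> (Suc n) (last gs)))"

text \<open>A DRGVR is any process, on any probability space, with these finite-dimensional
  distributions.\<close>

definition is_drgvr :: "'w measure \<Rightarrow> real \<Rightarrow> real \<Rightarrow> (nat \<Rightarrow> 'w \<Rightarrow> ugraph) \<Rightarrow> bool" where
  "is_drgvr M \<beta> \<epsilon> G \<longleftrightarrow>
     prob_space M \<and>
     (\<forall>n. (\<lambda>\<omega>. map (\<lambda>k. G k \<omega>) [0..<Suc n]) \<in> measurable M (count_space UNIV) \<and>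
          distr M (count_space UNIV) (\<lambda>\<omega>. map (\<lambda>k. G k \<omega>) [0..<Suc n])
            = measure_pmf (drgvr_history \<beta> \<epsilon> n))"

text \<open>Edges point from the larger (later-born) label to the smaller one.\<close>

definition orient :: "ugraph \<Rightarrow> nat pair_pre_digraph" where
  "orient g = \<lparr> pverts = vertices g, parcs = {(j, i). i < j \<and> {i, j} \<in> edges g} \<rparr>"

text \<open>The \<open>i\<close>-th smallest element of \<open>V\<close>, counting from \<open>1\<close>.\<close>

definition nth_vertex :: "nat set \<Rightarrow> nat \<Rightarrow> nat" where
  "nth_vertex V i = sorted_list_of_set V ! (i - 1)"

text \<open>The oriented graph transported to \<open>{1, \<dots>, |V|}\<close> by identifying \<open>v\<^sub>i\<close> with \<open>i\<close>.\<close>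

definition orient_relabelled :: "ugraph \<Rightarrow> nat pair_pre_digraph" where
  "orient_relabelled g =
     (let N = card (vertices g); v = nth_vertex (vertices g) in
      \<lparr> pverts = {1..N},
        parcs = {(j, i). j \<in> {1..N} \<and> i \<in> {1..N} \<and> (v j, v i) \<in> parcs (orient g)} \<rparr>)"

definition out_degrees :: "ugraph \<Rightarrow> nat list" where
  "out_degrees g =
     map (\<lambda>i. out_degree (with_proj (orient g)) (nth_vertex (vertices g) i))
         [1..<Suc (card (vertices g))]"

text \<open>The locale \<^locale>\<open>pair_digraph\<close> describes finite directed graphs without loops. Only
  the arc sets are compared; the vertex sets of the two graphs may differ arbitrarily.\<close>

definition digraph_lipschitz :: "real \<Rightarrow> (nat pair_pre_digraph \<Rightarrow> real) \<Rightarrow> bool" where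
  "digraph_lipschitz L f \<longleftrightarrow>
     (\<forall>H1 H2. pair_digraph H1 \<longrightarrow> pair_digraph H2 \<longrightarrow>
        card (parcs H1 - parcs H2) + card (parcs H2 - parcs H1) \<le> 1 \<longrightarrow>
        \<bar>f H1 - f H2\<bar> \<le> L)"

text \<open>Conditional expectation and probability given the \<open>\<sigma>\<close>-algebra generated by a discrete
  random variable \<open>X\<close>.\<close>

definition cond_exp_given :: "'w measure \<Rightarrow> ('w \<Rightarrow> 'b) \<Rightarrow> ('w \<Rightarrow> real) \<Rightarrow> 'w \<Rightarrow> real" where
  "cond_exp_given M X Y =
     real_cond_exp M (vimage_algebra (space M) X (count_space UNIV)) Y"

definition cond_prob_given :: "'w measure \<Rightarrow> ('w \<Rightarrow> 'b) \<Rightarrow> 'w set \<Rightarrow> 'w \<Rightarrow> real" where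
  "cond_prob_given M X A = cond_exp_given M X (indicator A)"

text \<open>\<open>2 exp (- t\<^sup>2 / s)\<close> for \<open>s, t \<ge> 0\<close>. At \<open>s = 0\<close> the HOL convention \<open>x / 0 = 0\<close> would give the
  void bound \<open>2\<close>; the intended value for \<open>t > 0\<close> is the limit \<open>0\<close> as \<open>s\<close> decreases to \<open>0\<close>.\<close>

definition gauss_tail :: "real \<Rightarrow> real \<Rightarrow> real" where
  "gauss_tail t s = (if s = 0 \<and> t > 0 then 0 else 2 * exp (- (t\<^sup>2 / s)))"

end

(* A directed graph with m arcs is built by revealing its arcs one at a time, and each revealed arc
   changes the conditional mean of f by at most 2L; Hoeffding's lemma for every step and Chernoff's
   bound give the tail.

   Given the vertex history the arcs of G_n are independent, an arc with tail j having a probability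
   that depends on j and the history only. Conditioning on the number of arcs therefore yields a random
   m-subset S of the possible arcs with weight proportional to the product of a(e) over e in S and of
   1 - a(e) over the other arcs e. Revealing S in uniformly random order, the rest is again of this
   form, and the means after revealing x or y first are compared by swapping one arc; this rests on
   the stochastic monotonicity of such subsets in their size, a consequence of Newton's inequality.
   Conditioning on the out-degrees instead makes the out-neighbourhoods independent uniform subsets of
   fixed sizes, whatever the history, and the bounds for the individual vertices multiply. *)

theory Submission
  imports Defs
begin

section \<open>Weighted random subsets of fixed size\<close>

text \<open>Deciding the possible arcs one after another would cost one increment per possible arc.
  Revealing the members of the random subset costs one per arc that is present, and this is how the
  number of edges enters the exponent. Two candidates \<open>x\<close> and \<open>y\<close> for the
  first arc leave different laws for the rest: each is a mixture of two layers over
  \<open>E - {x, y}\<close>, according to whether the other candidate belongs to the rest, and the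
  mixing proportions differ. Subsets of different sizes then have to be compared, hence the need for
  monotonicity in the size. An edge probability may equal 1, so \<open>1 - a e\<close> can vanish
  and a whole layer can lose its mass. Means are therefore kept as unnormalised sums and compared
  after cross-multiplication. Constants: exchanging one arc for another is a deletion and an
  insertion, so \<open>c = 2 * L\<close>; Hoeffding's lemma costs
  \<open>c\<^sup>2 / 8 = L\<^sup>2 / 2\<close> per arc; optimising Chernoff's bound with
  \<open>m\<close> arcs gives \<open>2 * exp (- t\<^sup>2 / (2 * m * L\<^sup>2))\<close>. The
  denominator \<open>8 * m * L\<^sup>2\<close> of the theorem thus leaves a factor of four to
  spare.\<close>

definition layer :: "'a set \<Rightarrow> int \<Rightarrow> 'a set set" where
  "layer E r = {S. S \<subseteq> E \<and> int (card S) = r}"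

definition wt :: "('a \<Rightarrow> real) \<Rightarrow> ('a \<Rightarrow> real) \<Rightarrow> 'a set \<Rightarrow> 'a set \<Rightarrow> real" where
  "wt a b E S = (\<Prod>e\<in>S. a e) * (\<Prod>e\<in>E - S. b e)"

text \<open>An unnormalised mean over the layer; the total weight, which may be zero, is the case
  \<open>g = 1\<close>. For finite \<open>E\<close> that total is the coefficient of
  \<open>X^r\<close> in the product of the polynomials \<open>b e + a e * X\<close>.\<close>

definition lsum :: "('a \<Rightarrow> real) \<Rightarrow> ('a \<Rightarrow> real) \<Rightarrow> 'a set \<Rightarrow> int \<Rightarrow> ('a set \<Rightarrow> real) \<Rightarrow> real" where
  "lsum a b E r g = (\<Sum>S\<in>layer E r. wt a b E S * g S)"

lemma finite_layer: "finite E \<Longrightarrow> finite (layer E r)"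
  unfolding layer_def by (rule finite_subset[of _ "Pow E"]) auto

lemma lsum_cong: "(\<And>S. S \<in> layer E r \<Longrightarrow> g S = h S) \<Longrightarrow> lsum a b E r g = lsum a b E r h"
  unfolding lsum_def by (intro sum.cong) auto

lemma wt_insert:
  assumes "finite E" "x \<notin> E" "S \<subseteq> E"
  shows "wt a b (insert x E) S = b x * wt a b E S"
    and "wt a b (insert x E) (insert x S) = a x * wt a b E S"
proof -
  have fS: "finite S" "x \<notin> S" using assms finite_subset by auto
  have "insert x E - S = insert x (E - S)" "insert x E - insert x S = E - S"
    using assms fS by auto
  then show "wt a b (insert x E) S = b x * wt a b E S"
    and "wt a b (insert x E) (insert x S) = a x * wt a b E S"
    using assms fS by (simp_all add: wt_def)
qed

lemma layer_insert:
  assumes "finite E" "x \<notin> E"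
  shows "layer (insert x E) r = layer E r \<union> insert x ` layer E (r - 1)"
proof (intro equalityI subsetI)
  fix S assume S: "S \<in> layer (insert x E) r"
  then have f: "finite S" using assms finite_subset[of S "insert x E"] by (simp add: layer_def)
  show "S \<in> layer E r \<union> insert x ` layer E (r - 1)"
  proof (cases "x \<in> S")
    case True
    then have "card S = Suc (card (S - {x}))" using f card.remove[of S x] by simp
    then have "S - {x} \<in> layer E (r - 1)" "S = insert x (S - {x})"
      using S True by (auto simp: layer_def)
    then show ?thesis by blast
  qed (use S in \<open>auto simp: layer_def\<close>)
next
  fix S assume "S \<in> layer E r \<union> insert x ` layer E (r - 1)"
  then show "S \<in> layer (insert x E) r"
  proof
    assume "S \<in> insert x ` layer E (r - 1)"
    then obtain T where T: "S = insert x T" "T \<subseteq> E" "int (card T) = r - 1"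
      by (auto simp: layer_def)
    then have "finite T" "x \<notin> T" using assms finite_subset by auto
    with T show ?thesis by (auto simp: layer_def)
  qed (auto simp: layer_def)
qed

text \<open>Split by membership of \<open>x\<close>; this recursion drives the inductions on
  \<open>E\<close>. Sizes are integers so that \<open>r - 1\<close> at \<open>r = 0\<close> names an
  empty layer and no boundary case arises.\<close>

lemma lsum_insert:
  assumes "finite E" "x \<notin> E"
  shows "lsum a b (insert x E) r g
    = b x * lsum a b E r g + a x * lsum a b E (r - 1) (\<lambda>S. g (insert x S))"
proof -
  have disj: "layer E r \<inter> insert x ` layer E (r - 1) = {}"
    using assms by (auto simp: layer_def)
  have inj: "inj_on (insert x) (layer E (r - 1))"
    using assms by (auto simp: inj_on_def layer_def dest: insert_ident)
  have "lsum a b (insert x E) r g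
     = (\<Sum>S\<in>layer E r. wt a b (insert x E) S * g S)
     + (\<Sum>S\<in>layer E (r - 1). wt a b (insert x E) (insert x S) * g (insert x S))"
    unfolding lsum_def layer_insert[OF assms]
    by (subst sum.union_disjoint)
       (use disj inj assms in \<open>auto simp: finite_layer sum.reindex o_def\<close>)
  also have "(\<Sum>S\<in>layer E r. wt a b (insert x E) S * g S) = b x * lsum a b E r g"
    unfolding lsum_def sum_distrib_left using assms
    by (intro sum.cong) (auto simp: wt_insert layer_def)
  also have "(\<Sum>S\<in>layer E (r - 1). wt a b (insert x E) (insert x S) * g (insert x S))
     = a x * lsum a b E (r - 1) (\<lambda>S. g (insert x S))"
    unfolding lsum_def sum_distrib_left using assms
    by (intro sum.cong) (auto simp: wt_insert layer_def)
  finally show ?thesis .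
qed

lemma wt_nonneg:
  assumes "\<And>e. e \<in> E \<Longrightarrow> 0 \<le> a e" "\<And>e. e \<in> E \<Longrightarrow> 0 \<le> b e" "S \<subseteq> E"
  shows "0 \<le> wt a b E S"
  unfolding wt_def using assms by (intro mult_nonneg_nonneg prod_nonneg) auto

lemma lsum_mono:
  assumes "\<And>e. e \<in> E \<Longrightarrow> 0 \<le> a e" "\<And>e. e \<in> E \<Longrightarrow> 0 \<le> b e"
    and "\<And>S. S \<in> layer E r \<Longrightarrow> g S \<le> h S"
  shows "lsum a b E r g \<le> lsum a b E r h"
  unfolding lsum_def
  by (intro sum_mono mult_left_mono wt_nonneg assms(3)) (auto simp: layer_def assms(1,2))

lemma lsum_add: "lsum a b E r (\<lambda>S. g S + h S) = lsum a b E r g + lsum a b E r h"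
  unfolding lsum_def by (simp add: algebra_simps sum.distrib)

lemma lsum_cmult: "lsum a b E r (\<lambda>S. c * g S) = c * lsum a b E r g"
  unfolding lsum_def by (simp add: sum_distrib_left algebra_simps)

lemma lsum_const: "lsum a b E r (\<lambda>_. c) = c * lsum a b E r (\<lambda>_. 1)"
  using lsum_cmult[of a b E r c "\<lambda>_. 1"] by simp

lemma lsum_nonneg:
  assumes "\<And>e. e \<in> E \<Longrightarrow> 0 \<le> a e" "\<And>e. e \<in> E \<Longrightarrow> 0 \<le> b e"
    and "\<And>S. S \<in> layer E r \<Longrightarrow> 0 \<le> g S"
  shows "0 \<le> lsum a b E r g"
  unfolding lsum_def
  by (intro sum_nonneg mult_nonneg_nonneg wt_nonneg assms(3)) (auto simp: layer_def assms(1,2))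

text \<open>Nonnegative weights with sum zero all vanish. This makes the convention
  \<open>0 / 0 = 0\<close> harmless wherever a mean over a massless layer appears.\<close>

lemma lsum_total_zero:
  assumes "finite E" "\<And>e. e \<in> E \<Longrightarrow> 0 \<le> a e" "\<And>e. e \<in> E \<Longrightarrow> 0 \<le> b e"
    and "lsum a b E r (\<lambda>_. 1) = 0"
  shows "lsum a b E r g = 0"
proof -
  have "\<forall>S\<in>layer E r. wt a b E S = 0"
    using assms(4) unfolding lsum_def
    by (subst (asm) sum_nonneg_eq_0_iff)
       (auto simp: finite_layer assms layer_def intro!: wt_nonneg)
  then show ?thesis by (simp add: lsum_def)
qed

lemma lsum_empty: "lsum a b ({} :: 'a set) r g = (if r = 0 then g {} else 0)"
proof -
  have "layer ({} :: 'a set) r = (if r = 0 then {{}} else {})" by (auto simp: layer_def)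
  then show ?thesis by (cases "r = 0") (simp_all only: lsum_def wt_def if_True if_False, simp_all)
qed

section \<open>Log-concavity of the layer masses and monotonicity in the size\<close>

text \<open>Newton's inequality in the form without division, which survives vanishing weights.\<close>

lemma lsum_log_concave:
  assumes "finite E" "\<And>e. e \<in> E \<Longrightarrow> 0 \<le> a e" "\<And>e. e \<in> E \<Longrightarrow> 0 \<le> b e" "s \<le> r"
  shows "lsum a b E (r + 1) (\<lambda>_. 1) * lsum a b E (s - 1) (\<lambda>_. 1)
       \<le> lsum a b E r (\<lambda>_. 1) * lsum a b E s (\<lambda>_. 1)"
  using assms
proof (induction E arbitrary: r s rule: finite_induct)
  case empty
  then show ?case by (auto simp: lsum_empty)
next
  case (insert x E)
  define Z where "Z k = lsum a b E k (\<lambda>_. 1)" for k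
  have nn: "0 \<le> a x" "0 \<le> b x" using insert.prems by auto
  have IH: "Z (r + 1) * Z (s - 1) \<le> Z r * Z s" if "s \<le> r" for r s
    unfolding Z_def using insert.IH insert.prems that by auto
  \<comment> \<open>This is the mixed term. Even for \<open>s = r\<close> it is the off-diagonal
    instance \<open>Z (r + 1) * Z (r - 2) \<le> Z r * Z (r - 1)\<close>, whose derivation from
    diagonal instances would divide by possibly vanishing masses. Hence the induction runs over all
    \<open>s \<le> r\<close>.\<close>
  have mid: "Z (r + 1) * Z (s - 2) \<le> Z (r - 1) * Z s"
  proof (cases "s \<le> r - 1")
    case True
    have "Z (r + 1) * Z (s - 2) \<le> Z r * Z (s - 1)"
      using IH[of "s - 1" r] insert.prems(3) by (simp add: algebra_simps)
    also have "\<dots> \<le> Z (r - 1) * Z s" using IH[of s "r - 1"] True by simp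
    finally show ?thesis .
  next
    case False
    then have "r = s" using insert.prems(3) by simp
    then show ?thesis using IH[of "s - 1" r] by (simp add: algebra_simps)
  qed
  have rec: "lsum a b (insert x E) k (\<lambda>_. 1) = b x * Z k + a x * Z (k - 1)" for k
    unfolding Z_def by (rule lsum_insert[OF insert.hyps])
  have 1: "(b x)\<^sup>2 * (Z (r + 1) * Z (s - 1)) \<le> (b x)\<^sup>2 * (Z r * Z s)"
    using IH[OF insert.prems(3)] by (intro mult_left_mono) auto
  have 2: "(a x)\<^sup>2 * (Z r * Z (s - 2)) \<le> (a x)\<^sup>2 * (Z (r - 1) * Z (s - 1))"
    using IH[of "s - 1" "r - 1"] insert.prems(3) by (intro mult_left_mono) auto
  have 3: "(a x * b x) * (Z (r + 1) * Z (s - 2)) \<le> (a x * b x) * (Z (r - 1) * Z s)"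
    using mid nn by (intro mult_left_mono) auto
  have rec1: "lsum a b (insert x E) (r + 1) (\<lambda>_. 1) = b x * Z (r + 1) + a x * Z r"
    and rec2: "lsum a b (insert x E) (s - 1) (\<lambda>_. 1) = b x * Z (s - 1) + a x * Z (s - 2)"
    using rec[of "r + 1"] rec[of "s - 1"] by simp_all
  \<comment> \<open>The product \<open>Z r * Z (s - 1)\<close> occurs with factor
    \<open>a x * b x\<close> on both sides and cancels; what remains is three differences of known
    sign.\<close>
  have "(b x * Z r + a x * Z (r - 1)) * (b x * Z s + a x * Z (s - 1))
      - (b x * Z (r + 1) + a x * Z r) * (b x * Z (s - 1) + a x * Z (s - 2))
    = ((b x)\<^sup>2 * (Z r * Z s) - (b x)\<^sup>2 * (Z (r + 1) * Z (s - 1)))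
    + ((a x)\<^sup>2 * (Z (r - 1) * Z (s - 1)) - (a x)\<^sup>2 * (Z r * Z (s - 2)))
    + ((a x * b x) * (Z (r - 1) * Z s) - (a x * b x) * (Z (r + 1) * Z (s - 2)))"
    by algebra
  then show ?case unfolding rec1 rec2 rec[of r] rec[of s] using 1 2 3 by linarith
qed

text \<open>The random \<open>r\<close>-subset can be coupled inside the random \<open>(r + 1)\<close>-subset with the same
  weights; the inequality between means below is the dual form of that coupling.\<close>

lemma lsum_shift:
  assumes "finite E" "\<And>e. e \<in> E \<Longrightarrow> 0 \<le> a e" "\<And>e. e \<in> E \<Longrightarrow> 0 \<le> b e"
    and "\<And>A z. A \<in> layer E r \<Longrightarrow> z \<in> E - A \<Longrightarrow> g (insert z A) \<le> h A"
  shows "lsum a b E (r + 1) g * lsum a b E r (\<lambda>_. 1)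
       \<le> lsum a b E r h * lsum a b E (r + 1) (\<lambda>_. 1)"
  using assms
proof (induction E arbitrary: r g h rule: finite_induct)
  case empty
  then show ?case by (auto simp: lsum_empty)
next
  case (insert x E)
  define Z where "Z k = lsum a b E k (\<lambda>_. 1)" for k
  define g' where "g' S = g (insert x S)" for S
  define h' where "h' S = h (insert x S)" for S
  have nn: "0 \<le> a x" "0 \<le> b x" and nE: "\<And>e. e \<in> E \<Longrightarrow> 0 \<le> a e" "\<And>e. e \<in> E \<Longrightarrow> 0 \<le> b e"
    using insert.prems by auto
  have sub: "A \<in> layer (insert x E) r" if "A \<in> layer E r" for A r
    using that by (auto simp: layer_def)
  have ins: "insert x A \<in> layer (insert x E) r" if "A \<in> layer E (r - 1)" for A r
    using that insert.hyps by (simp add: layer_insert)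
  have IH1: "lsum a b E (r + 1) g * Z r \<le> lsum a b E r h * Z (r + 1)"
    unfolding Z_def by (intro insert.IH nE) (use insert.prems(3) sub in auto)
  have IH2: "lsum a b E (r - 1 + 1) g' * Z (r - 1) \<le> lsum a b E (r - 1) h' * Z (r - 1 + 1)"
    unfolding Z_def
  proof (intro insert.IH nE)
    fix A z assume A: "A \<in> layer E (r - 1)" "z \<in> E - A"
    then have "z \<in> insert x E - insert x A" using insert.hyps by auto
    then show "g' (insert z A) \<le> h' A"
      using insert.prems(3)[OF ins[OF A(1)], of z]
      unfolding g'_def h'_def insert_commute[of x z] by blast
  qed auto
  \<comment> \<open>The hypothesis with \<open>x\<close> itself as the added element.\<close>
  have le: "lsum a b E r g' \<le> lsum a b E r h"
  proof (intro lsum_mono nE)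
    fix S assume "S \<in> layer E r"
    then show "g' S \<le> h S"
      unfolding g'_def using insert.hyps by (intro insert.prems(3) sub) (auto simp: layer_def)
  qed
  have Znn: "0 \<le> Z k" for k unfolding Z_def by (intro lsum_nonneg nE) auto
  have zero: "lsum a b E k u = 0" if "Z k = 0" for k u
    using lsum_total_zero[OF insert.hyps(1) nE] that by (auto simp: Z_def)
  have lc: "Z (r + 1) * Z (r - 1) \<le> Z r * Z r"
    unfolding Z_def by (intro lsum_log_concave insert.hyps nE) auto
  \<comment> \<open>The mixed term cannot be compared summand by summand, because the masses paired
    with \<open>g\<close> and \<open>h\<close> differ from those paired with \<open>g'\<close> and
    \<open>h'\<close>.\<close>
  have mid: "lsum a b E (r + 1) g * Z (r - 1) + lsum a b E r g' * Z r
           \<le> lsum a b E r h * Z r + lsum a b E (r - 1) h' * Z (r + 1)"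
  proof (cases "Z r = 0")
    case True
    \<comment> \<open>Log-concavity forbids an internal zero: one neighbouring mass vanishes too,
      and then every product in the claim is zero.\<close>
    then have "Z (r + 1) * Z (r - 1) = 0"
      using lc mult_nonneg_nonneg[OF Znn Znn] by (intro antisym) auto
    then have "Z (r + 1) = 0 \<or> Z (r - 1) = 0" by (simp only: mult_eq_0_iff)
    then show ?thesis using True zero by auto
  next
    case False
    then have pos: "Z r > 0" using Znn[of r] by simp
    \<comment> \<open>A transport argument. Log-concavity gives \<open>P \<le> Z r\<close>. The
      \<open>g\<close> term is absorbed by the share \<open>P\<close> of \<open>h\<close>; the share
      \<open>P\<close> of \<open>g'\<close> goes to \<open>h'\<close>; the excess
      \<open>Z r - P\<close> of \<open>g'\<close> goes to the remaining share of \<open>h\<close> by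
      \<open>le\<close>.\<close>
    define P where "P = Z (r + 1) * Z (r - 1) / Z r"
    have P: "0 \<le> P" "P \<le> Z r" using lc pos Znn by (auto simp: P_def field_simps)
    have "lsum a b E (r + 1) g * Z (r - 1) = lsum a b E (r + 1) g * Z r * Z (r - 1) / Z r"
      using pos by simp
    also have "\<dots> \<le> lsum a b E r h * Z (r + 1) * Z (r - 1) / Z r"
      using IH1 Znn by (intro divide_right_mono mult_right_mono) auto
    also have "\<dots> = lsum a b E r h * P" by (simp add: P_def)
    finally have A: "lsum a b E (r + 1) g * Z (r - 1) \<le> lsum a b E r h * P" .
    have "lsum a b E r g' * P = lsum a b E r g' * Z (r - 1) * Z (r + 1) / Z r"
      by (simp add: P_def)
    also have "\<dots> \<le> lsum a b E (r - 1) h' * Z r * Z (r + 1) / Z r"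
      using IH2 Znn by (intro divide_right_mono mult_right_mono) auto
    also have "\<dots> = lsum a b E (r - 1) h' * Z (r + 1)" using pos by simp
    finally have B: "lsum a b E r g' * P \<le> lsum a b E (r - 1) h' * Z (r + 1)" .
    have "lsum a b E r g' * (Z r - P) \<le> lsum a b E r h * (Z r - P)"
      using le P by (intro mult_right_mono) auto
    then show ?thesis using A B by (simp add: algebra_simps)
  qed
  have rec: "lsum a b (insert x E) k u
      = b x * lsum a b E k u + a x * lsum a b E (k - 1) (\<lambda>S. u (insert x S))" for k u
    by (rule lsum_insert[OF insert.hyps])
  have 1: "(b x)\<^sup>2 * (lsum a b E (r + 1) g * Z r) \<le> (b x)\<^sup>2 * (lsum a b E r h * Z (r + 1))"
    using IH1 by (intro mult_left_mono) auto
  have 2: "(a x)\<^sup>2 * (lsum a b E r g' * Z (r - 1)) \<le> (a x)\<^sup>2 * (lsum a b E (r - 1) h' * Z r)"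
    using IH2 by (intro mult_left_mono) auto
  have 3: "(a x * b x) * (lsum a b E (r + 1) g * Z (r - 1) + lsum a b E r g' * Z r)
     \<le> (a x * b x) * (lsum a b E r h * Z r + lsum a b E (r - 1) h' * Z (r + 1))"
    using mid nn by (intro mult_left_mono) auto
  have recg: "lsum a b (insert x E) (r + 1) g = b x * lsum a b E (r + 1) g + a x * lsum a b E r g'"
    and rech: "lsum a b (insert x E) r h = b x * lsum a b E r h + a x * lsum a b E (r - 1) h'"
    and rec1: "lsum a b (insert x E) r (\<lambda>_. 1) = b x * Z r + a x * Z (r - 1)"
    and rec2: "lsum a b (insert x E) (r + 1) (\<lambda>_. 1) = b x * Z (r + 1) + a x * Z r"
    using rec[of "r + 1" g] rec[of r h] rec[of r "\<lambda>_. 1"] rec[of "r + 1" "\<lambda>_. 1"]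
    unfolding g'_def h'_def Z_def by (simp_all only: add_diff_cancel_right')
  have "(b x * G1 + a x * G0) * (b x * Z r + a x * Z (r - 1))
     + ((b x)\<^sup>2 * (H0 * Z (r + 1)) - (b x)\<^sup>2 * (G1 * Z r))
     + ((a x)\<^sup>2 * (H1 * Z r) - (a x)\<^sup>2 * (G0 * Z (r - 1)))
     + ((a x * b x) * (H0 * Z r + H1 * Z (r + 1)) - (a x * b x) * (G1 * Z (r - 1) + G0 * Z r))
    = (b x * H0 + a x * H1) * (b x * Z (r + 1) + a x * Z r)" for G0 G1 H0 H1
    by algebra
  from this[of "lsum a b E (r + 1) g" "lsum a b E r g'" "lsum a b E r h" "lsum a b E (r - 1) h'"]
  show ?case unfolding recg rech rec1 rec2 using 1 2 3 by linarith
qed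

lemma lsum_shift':
  assumes "finite E" "\<And>e. e \<in> E \<Longrightarrow> 0 \<le> a e" "\<And>e. e \<in> E \<Longrightarrow> 0 \<le> b e"
    and "\<And>A z. A \<in> layer E r \<Longrightarrow> z \<in> E - A \<Longrightarrow> h A \<le> g (insert z A)"
  shows "lsum a b E r h * lsum a b E (r + 1) (\<lambda>_. 1)
       \<le> lsum a b E (r + 1) g * lsum a b E r (\<lambda>_. 1)"
proof -
  have *: "lsum a b E k (\<lambda>S. - u S) = - lsum a b E k u" for k u
    using lsum_cmult[of a b E k "-1" u] by simp
  show ?thesis
    using lsum_shift[of E a b r "\<lambda>S. - g S" "\<lambda>S. - h S"] assms by (simp add: *)
qed

section \<open>The exchange inequality and size biasing\<close>

text \<open>Within a layer of finite sets the two cardinality conditions leave only the exchange of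
  one element for another. Only sets of the family are compared, since the intermediate set of an
  exchange has a different size.\<close>

definition swap_lipschitz :: "real \<Rightarrow> 'a set set \<Rightarrow> ('a set \<Rightarrow> real) \<Rightarrow> bool" where
  "swap_lipschitz c \<B> g \<longleftrightarrow>
     (\<forall>S\<in>\<B>. \<forall>T\<in>\<B>. card (S - T) \<le> 1 \<longrightarrow> card (T - S) \<le> 1 \<longrightarrow> \<bar>g S - g T\<bar> \<le> c)"

lemma swap_lipschitzD:
  assumes "swap_lipschitz c \<B> g" "S \<in> \<B>" "T \<in> \<B>" "S - T \<subseteq> {x}" "T - S \<subseteq> {y}"
  shows "g S \<le> g T + c"
proof -
  have "card (S - T) \<le> 1" "card (T - S) \<le> 1"
    using card_mono[OF _ assms(4)] card_mono[OF _ assms(5)] by auto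
  then have "\<bar>g S - g T\<bar> \<le> c" using assms by (auto simp: swap_lipschitz_def)
  then show ?thesis by linarith
qed

text \<open>Cross-multiplied form of: the conditional mean after revealing \<open>x\<close> exceeds
  the one after revealing \<open>y\<close> by at most \<open>c\<close>. Both remainders are split by
  whether they contain the other element, leaving layers over \<open>D = E - {x, y}\<close>; each of
  the four pairings amounts to one exchange.\<close>

lemma lsum_exchange:
  assumes fin: "finite E" and a: "\<And>e. e \<in> E \<Longrightarrow> 0 \<le> a e" and b: "\<And>e. e \<in> E \<Longrightarrow> 0 \<le> b e"
    and lip: "swap_lipschitz c (layer E r) g" and "0 \<le> c" and x: "x \<in> E" and y: "y \<in> E"
  shows "lsum a b (E - {x}) (r - 1) (\<lambda>S. g (insert x S)) * lsum a b (E - {y}) (r - 1) (\<lambda>_. 1)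
    \<le> (lsum a b (E - {y}) (r - 1) (\<lambda>S. g (insert y S)) + c * lsum a b (E - {y}) (r - 1) (\<lambda>_. 1))
        * lsum a b (E - {x}) (r - 1) (\<lambda>_. 1)"
proof (cases "x = y")
  case True
  have "0 \<le> lsum a b (E - {y}) (r - 1) (\<lambda>_. 1)" using a b by (intro lsum_nonneg) auto
  with \<open>0 \<le> c\<close> show ?thesis unfolding True by (intro mult_right_mono) auto
next
  case False
  define D where "D = E - {x, y}"
  define Z where "Z k = lsum a b D k (\<lambda>_. 1)" for k
  have D: "finite D" "x \<notin> D" "y \<notin> D" "E - {x} = insert y D" "E - {y} = insert x D"
    and E: "E = insert x (insert y D)"
    using fin x y False by (auto simp: D_def)
  have nD: "\<And>e. e \<in> D \<Longrightarrow> 0 \<le> a e" "\<And>e. e \<in> D \<Longrightarrow> 0 \<le> b e" 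
    and nn: "0 \<le> a x" "0 \<le> a y" "0 \<le> b x" "0 \<le> b y" using a b E by auto
  define q where "q S = g (insert x (insert y S))" for S
  define gx where "gx S = g (insert x S)" for S
  define h where "h S = g (insert y S) + c" for S
  have mem1: "insert x S \<in> layer E r" "insert y S \<in> layer E r" if "S \<in> layer D (r - 1)" for S
  proof -
    have "finite S" using that D finite_subset by (auto simp: layer_def)
    then show "insert x S \<in> layer E r" "insert y S \<in> layer E r"
      using that D E by (auto simp: layer_def card_insert_if)
  qed
  have mem2: "insert x (insert y S) \<in> layer E r" if "S \<in> layer D (r - 1 - 1)" for S
  proof -
    have "finite S" using that D finite_subset by (auto simp: layer_def)
    then show ?thesis using that D E False by (auto simp: layer_def card_insert_if)
  qed
  have memz: "insert z A \<in> layer D (r - 1)" if "A \<in> layer D (r - 1 - 1)" "z \<in> D - A" for A z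
  proof -
    have "finite A" using that D finite_subset by (auto simp: layer_def)
    then show ?thesis using that by (auto simp: layer_def card_insert_if)
  qed
  have le1: "lsum a b D (r - 1) gx \<le> lsum a b D (r - 1) h"
  proof (intro lsum_mono nD)
    fix S assume "S \<in> layer D (r - 1)"
    then show "gx S \<le> h S" unfolding gx_def h_def
      by (intro swap_lipschitzD[OF lip, of _ _ x y] mem1) auto
  qed
  have le2: "lsum a b D (r - 1 - 1) q \<le> lsum a b D (r - 1 - 1) (\<lambda>S. q S + c)"
    using \<open>0 \<le> c\<close> by (intro lsum_mono nD) auto
  \<comment> \<open>Here the sizes over \<open>D\<close> differ by one: \<open>x, y, A\<close> is
    compared with \<open>y, z, A\<close>, an exchange of \<open>x\<close> for the added
    \<open>z\<close>. In \<open>le4\<close> the exchange is \<open>z\<close> for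
    \<open>y\<close>.\<close>
  have le3: "lsum a b D (r - 1 - 1) q * Z (r - 1) \<le> lsum a b D (r - 1) h * Z (r - 1 - 1)"
  proof -
    have "lsum a b D (r - 1 - 1) q * lsum a b D (r - 1 - 1 + 1) (\<lambda>_. 1)
      \<le> lsum a b D (r - 1 - 1 + 1) h * lsum a b D (r - 1 - 1) (\<lambda>_. 1)"
    proof (intro lsum_shift' D nD)
      fix A z assume A: "A \<in> layer D (r - 1 - 1)" "z \<in> D - A"
      then show "q A \<le> h (insert z A)" unfolding q_def h_def
        by (intro swap_lipschitzD[OF lip, of _ _ x z] mem1 mem2 memz) auto
    qed
    then show ?thesis by (simp add: Z_def)
  qed
  have le4: "lsum a b D (r - 1) gx * Z (r - 1 - 1) \<le> lsum a b D (r - 1 - 1) (\<lambda>S. q S + c) * Z (r - 1)"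
  proof -
    have "lsum a b D (r - 1 - 1 + 1) gx * lsum a b D (r - 1 - 1) (\<lambda>_. 1)
      \<le> lsum a b D (r - 1 - 1) (\<lambda>S. q S + c) * lsum a b D (r - 1 - 1 + 1) (\<lambda>_. 1)"
    proof (intro lsum_shift D nD)
      fix A z assume A: "A \<in> layer D (r - 1 - 1)" "z \<in> D - A"
      then show "gx (insert z A) \<le> q A + c" unfolding q_def gx_def
        by (intro swap_lipschitzD[OF lip, of _ _ z y] mem1 mem2 memz) auto
    qed
    then show ?thesis by (simp add: Z_def)
  qed
  have Znn: "0 \<le> Z k" for k unfolding Z_def by (intro lsum_nonneg nD) auto
  have recx: "lsum a b (E - {x}) (r - 1) u
      = b y * lsum a b D (r - 1) u + a y * lsum a b D (r - 1 - 1) (\<lambda>S. u (insert y S))" for u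
    unfolding D(4) by (rule lsum_insert[OF D(1,3)])
  have recy: "lsum a b (E - {y}) (r - 1) u
      = b x * lsum a b D (r - 1) u + a x * lsum a b D (r - 1 - 1) (\<lambda>S. u (insert x S))" for u
    unfolding D(5) by (rule lsum_insert[OF D(1,2)])
  have X: "lsum a b (E - {x}) (r - 1) (\<lambda>S. g (insert x S))
      = b y * lsum a b D (r - 1) gx + a y * lsum a b D (r - 1 - 1) q"
    unfolding recx gx_def q_def by (simp add: insert_commute)
  have "lsum a b (E - {y}) (r - 1) (\<lambda>S. g (insert y S)) + c * lsum a b (E - {y}) (r - 1) (\<lambda>_. 1)
      = lsum a b (E - {y}) (r - 1) h"
    unfolding h_def by (simp add: lsum_add lsum_const[of a b "E - {y}" "r - 1" c])
  also have "\<dots> = b x * lsum a b D (r - 1) h + a x * lsum a b D (r - 1 - 1) (\<lambda>S. q S + c)"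
    unfolding recy h_def q_def by (simp add: insert_commute)
  finally have Y: "lsum a b (E - {y}) (r - 1) (\<lambda>S. g (insert y S)) + c * lsum a b (E - {y}) (r - 1) (\<lambda>_. 1)
      = b x * lsum a b D (r - 1) h + a x * lsum a b D (r - 1 - 1) (\<lambda>S. q S + c)" .
  have 1: "(b y * b x) * (lsum a b D (r - 1) gx * Z (r - 1)) \<le> (b y * b x) * (lsum a b D (r - 1) h * Z (r - 1))"
    using le1 nn Znn by (intro mult_left_mono mult_right_mono) auto
  have 2: "(a y * a x) * (lsum a b D (r - 1 - 1) q * Z (r - 1 - 1))
     \<le> (a y * a x) * (lsum a b D (r - 1 - 1) (\<lambda>S. q S + c) * Z (r - 1 - 1))"
    using le2 nn Znn by (intro mult_left_mono mult_right_mono) auto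
  have 3: "(a y * b x) * (lsum a b D (r - 1 - 1) q * Z (r - 1))
     \<le> (a y * b x) * (lsum a b D (r - 1) h * Z (r - 1 - 1))"
    using le3 nn by (intro mult_left_mono) auto
  have 4: "(b y * a x) * (lsum a b D (r - 1) gx * Z (r - 1 - 1))
     \<le> (b y * a x) * (lsum a b D (r - 1 - 1) (\<lambda>S. q S + c) * Z (r - 1))"
    using le4 nn by (intro mult_left_mono) auto
  let ?G = "lsum a b D (r - 1) gx" and ?Q = "lsum a b D (r - 1 - 1) q"
  let ?H = "lsum a b D (r - 1) h" and ?Q' = "lsum a b D (r - 1 - 1) (\<lambda>S. q S + c)"
  let ?U = "Z (r - 1)" and ?V = "Z (r - 1 - 1)"
  \<comment> \<open>Each of the four coefficient products selects one pairing of a remainder after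
    \<open>x\<close> with a remainder after \<open>y\<close>.\<close>
  have "(b x * H + a x * Q') * (b y * U + a y * V) - (b y * G + a y * Q) * (b x * U + a x * V)
    = (b y * b x * (H * U) - b y * b x * (G * U)) + (a y * a x * (Q' * V) - a y * a x * (Q * V))
    + (a y * b x * (H * V) - a y * b x * (Q * U)) + (b y * a x * (Q' * U) - b y * a x * (G * V))"
    for G Q H Q' U V :: real
    by algebra
  moreover have "0 \<le> (b y * b x * (?H * ?U) - b y * b x * (?G * ?U))
    + (a y * a x * (?Q' * ?V) - a y * a x * (?Q * ?V))
    + (a y * b x * (?H * ?V) - a y * b x * (?Q * ?U)) + (b y * a x * (?Q' * ?U) - b y * a x * (?G * ?V))"
    using 1 2 3 4 by (intro add_nonneg_nonneg) (simp_all only: diff_ge_0_iff_ge)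
  ultimately have "0 \<le> (b x * ?H + a x * ?Q') * (b y * ?U + a y * ?V)
      - (b y * ?G + a y * ?Q) * (b x * ?U + a x * ?V)"
    by (simp only:)
  then show ?thesis
    unfolding X Y diff_ge_0_iff_ge
    unfolding recx[of "\<lambda>_. 1"] recy[of "\<lambda>_. 1"] Z_def[symmetric] .
qed

text \<open>Double counting of pairs \<open>x \<in> S\<close>: every \<open>S\<close> is reached
  once from each of its \<open>r\<close> elements. Probabilistically, it disintegrates the random
  subset along a uniformly chosen element, the one revealed first.\<close>

lemma lsum_size_biased:
  assumes "finite E"
  shows "(\<Sum>x\<in>E. a x * lsum a b (E - {x}) (r - 1) (\<lambda>S. g (insert x S))) = of_int r * lsum a b E r g"
proof -
  have "a x * lsum a b (E - {x}) (r - 1) (\<lambda>S. g (insert x S))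
      = lsum a b E r (\<lambda>S. (if x \<in> S then 1 else 0) * g S)" if "x \<in> E" for x
  proof -
    have E: "E = insert x (E - {x})" using that by auto
    have "lsum a b (E - {x}) r (\<lambda>S. (if x \<in> S then 1 else 0) * g S) = lsum a b (E - {x}) r (\<lambda>_. 0)"
      by (intro lsum_cong) (auto simp: layer_def)
    also have "\<dots> = 0" by (simp add: lsum_def)
    finally show ?thesis
      using lsum_insert[of "E - {x}" x a b r "\<lambda>S. (if x \<in> S then 1 else 0) * g S"] assms E by simp
  qed
  then have "(\<Sum>x\<in>E. a x * lsum a b (E - {x}) (r - 1) (\<lambda>S. g (insert x S)))
    = (\<Sum>x\<in>E. lsum a b E r (\<lambda>S. (if x \<in> S then 1 else 0) * g S))" by (intro sum.cong) auto
  also have "\<dots> = (\<Sum>S\<in>layer E r. \<Sum>x\<in>E. wt a b E S * ((if x \<in> S then 1 else 0) * g S))"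
    unfolding lsum_def by (rule sum.swap)
  also have "\<dots> = (\<Sum>S\<in>layer E r. of_int r * (wt a b E S * g S))"
  proof (intro sum.cong refl)
    fix S assume S: "S \<in> layer E r"
    have "(\<Sum>x\<in>E. wt a b E S * ((if x \<in> S then 1 else 0) * g S))
      = wt a b E S * g S * (\<Sum>x\<in>E. if x \<in> S then 1 else 0)"
      by (simp add: sum_distrib_left algebra_simps)
    also have "(\<Sum>x\<in>E. if x \<in> S then 1 else (0::real)) = real (card S)"
    proof -
      have "E \<inter> {x. x \<in> S} = S" using S by (auto simp: layer_def)
      then show ?thesis using assms by (simp add: sum.If_cases)
    qed
    also have "real (card S) = of_int r" using S by (auto simp: layer_def)
    finally show "(\<Sum>x\<in>E. wt a b E S * ((if x \<in> S then 1 else 0) * g S)) = of_int r * (wt a b E S * g S)"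
      by simp
  qed
  finally show ?thesis by (simp add: lsum_def sum_distrib_left)
qed

section \<open>Concentration of swap-Lipschitz functions\<close>

text \<open>Hoeffding's lemma for the law proportional to \<open>u\<close>. The spread of
  \<open>y\<close> is controlled only where \<open>u\<close> is positive, because elsewhere
  \<open>y\<close> will be a quotient with denominator zero.\<close>

lemma hoeffding_weights:
  fixes u y :: "'a \<Rightarrow> real"
  assumes I: "finite I" and u: "\<And>x. x \<in> I \<Longrightarrow> 0 \<le> u x" and "0 < l"
    and y: "\<And>x x'. x \<in> I \<Longrightarrow> x' \<in> I \<Longrightarrow> 0 < u x \<Longrightarrow> 0 < u x' \<Longrightarrow> y x \<le> y x' + c"
  shows "(\<Sum>x\<in>I. u x * exp (l * y x))
    \<le> (\<Sum>x\<in>I. u x) * exp (l * ((\<Sum>x\<in>I. u x * y x) / (\<Sum>x\<in>I. u x)) + l\<^sup>2 * c\<^sup>2 / 8)"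
proof (cases "(\<Sum>x\<in>I. u x) = 0")
  case True
  then have "\<forall>x\<in>I. u x = 0" using I u by (simp add: sum_nonneg_eq_0_iff)
  then show ?thesis by simp
next
  case False
  define U where "U = (\<Sum>x\<in>I. u x)"
  have U: "0 < U" using False u unfolding U_def by (metis less_eq_real_def sum_nonneg)
  define w where "w x = (if x \<in> I then u x / U else 0)" for x
  have w: "0 \<le> w x" for x using u U by (simp add: w_def)
  have "(\<integral>\<^sup>+x. ennreal (w x) \<partial>count_space UNIV) = (\<Sum>x\<in>I. ennreal (w x))"
    using I by (intro nn_integral_count_space') (auto simp: w_def)
  also have "\<dots> = ennreal (\<Sum>x\<in>I. w x)" using w by (intro sum_ennreal) auto
  also have "(\<Sum>x\<in>I. w x) = (\<Sum>x\<in>I. u x / U)" by (intro sum.cong) (auto simp: w_def)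
  also have "\<dots> = 1" using U by (simp add: U_def flip: sum_divide_distrib)
  finally have w1: "(\<integral>\<^sup>+x. ennreal (w x) \<partial>count_space UNIV) = 1" by simp
  define p where "p = embed_pmf w"
  have pmf_p: "pmf p x = w x" for x unfolding p_def by (rule pmf_embed_pmf[OF w w1])
  have set_p: "set_pmf p = {x \<in> I. 0 < u x}"
  proof (intro set_eqI)
    fix x show "x \<in> set_pmf p \<longleftrightarrow> x \<in> {x \<in> I. 0 < u x}"
      using U u[of x] by (auto simp: set_pmf_eq pmf_p w_def)
  qed
  have fin: "finite (set_pmf p)" using I by (simp add: set_p)
  have E: "measure_pmf.expectation p h = (\<Sum>x\<in>I. u x * h x) / U" for h :: "'a \<Rightarrow> real"
  proof -
    have "measure_pmf.expectation p h = (\<Sum>x\<in>I. h x * pmf p x)"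
      using I by (intro integral_measure_pmf_real) (auto simp: set_p)
    also have "\<dots> = (\<Sum>x\<in>I. u x * h x / U)"
      by (intro sum.cong) (auto simp: pmf_p w_def)
    finally show ?thesis by (simp add: sum_divide_distrib)
  qed
  \<comment> \<open>Extremes over the support, so that the assumption on pairs of positive weight
    bounds \<open>B - A\<close> by \<open>c\<close>.\<close>
  define A where "A = Min (y ` set_pmf p)"
  define B where "B = Max (y ` set_pmf p)"
  have ne: "y ` set_pmf p \<noteq> {}" by (simp add: set_pmf_not_empty)
  have "A \<in> y ` set_pmf p" "B \<in> y ` set_pmf p"
    unfolding A_def B_def using ne fin by (auto intro!: Min_in Max_in)
  then have BA: "B - A \<le> c" using y by (fastforce simp: set_p)
  have AB: "A \<le> B" unfolding A_def B_def using fin ne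
    by (metis Max_ge Min_in finite_imageI)
  interpret interval_bounded_random_variable "measure_pmf p" y A B
    by unfold_locales (use fin in \<open>auto simp: AE_measure_pmf_iff A_def B_def\<close>)
  define \<mu> where "\<mu> = (\<Sum>x\<in>I. u x * y x) / U"
  have "nn_integral p (\<lambda>x. exp (l * (y x - \<mu>))) \<le> ennreal (exp (l\<^sup>2 * (B - \<mu> - (A - \<mu>))\<^sup>2 / 8))"
    using Hoeffdings_lemma_nn_integral[OF \<open>0 < l\<close>] unfolding E \<mu>_def by simp
  moreover have "nn_integral p (\<lambda>x. exp (l * (y x - \<mu>)))
      = ennreal (measure_pmf.expectation p (\<lambda>x. exp (l * (y x - \<mu>))))"
    by (intro nn_integral_eq_integral integrable_measure_pmf_finite fin) auto
  ultimately have "measure_pmf.expectation p (\<lambda>x. exp (l * (y x - \<mu>))) \<le> exp (l\<^sup>2 * (B - A)\<^sup>2 / 8)"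
    by simp
  also have "\<dots> \<le> exp (l\<^sup>2 * c\<^sup>2 / 8)"
    using AB BA by (simp add: mult_left_mono power_mono)
  finally have 1: "(\<Sum>x\<in>I. u x * exp (l * (y x - \<mu>))) / U \<le> exp (l\<^sup>2 * c\<^sup>2 / 8)"
    unfolding E .
  have "(\<Sum>x\<in>I. u x * exp (l * y x)) = (\<Sum>x\<in>I. u x * exp (l * (y x - \<mu>))) * exp (l * \<mu>)"
    unfolding sum_distrib_right
    by (intro sum.cong refl) (simp add: algebra_simps flip: exp_add)
  also have "\<dots> \<le> (U * exp (l\<^sup>2 * c\<^sup>2 / 8)) * exp (l * \<mu>)"
    using 1 U by (intro mult_right_mono) (auto simp: field_simps)
  also have "\<dots> = U * exp (l * \<mu> + l\<^sup>2 * c\<^sup>2 / 8)" by (simp add: exp_add)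
  finally show ?thesis unfolding \<mu>_def U_def .
qed

text \<open>A sub-Gaussian bound on the moment generating function, with \<open>v\<close> being half
  the usual variance proxy. Positive \<open>l\<close> are enough: the lower tail comes from
  \<open>- g\<close>, which has the same Lipschitz constant.\<close>

definition swap_concentrated :: "real \<Rightarrow> real \<Rightarrow> 'a set set \<Rightarrow> ('a set \<Rightarrow> real) \<Rightarrow> bool" where
  "swap_concentrated c v \<B> W \<longleftrightarrow>
     (\<forall>g l. swap_lipschitz c \<B> g \<longrightarrow> 0 < l \<longrightarrow>
        (\<Sum>S\<in>\<B>. W S * exp (l * g S))
          \<le> (\<Sum>S\<in>\<B>. W S) * exp (l * ((\<Sum>S\<in>\<B>. W S * g S) / (\<Sum>S\<in>\<B>. W S)) + v * l\<^sup>2))"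

text \<open>Reveal the elements of the random subset one at a time in uniformly random order. Given the
  first one, the rest is again a random subset with the same weights, and by the exchange inequality
  its conditional mean varies by at most \<open>c\<close>, so each revealed element costs one application of
  Hoeffding's lemma.\<close>

lemma swap_concentrated_layer:
  assumes "finite E" "\<And>e. e \<in> E \<Longrightarrow> 0 \<le> a e" "\<And>e. e \<in> E \<Longrightarrow> 0 \<le> b e" "0 \<le> c"
  shows "swap_concentrated c (real m * c\<^sup>2 / 8) (layer E (int m)) (wt a b E)"
  unfolding swap_concentrated_def
proof (intro allI impI)
  fix g l
  assume "swap_lipschitz c (layer E (int m)) g" and l: "0 < (l :: real)"
  then show "(\<Sum>S\<in>layer E (int m). wt a b E S * exp (l * g S))
     \<le> (\<Sum>S\<in>layer E (int m). wt a b E S) * exp (l * ((\<Sum>S\<in>layer E (int m). wt a b E S * g S)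
          / (\<Sum>S\<in>layer E (int m). wt a b E S)) + real m * c\<^sup>2 / 8 * l\<^sup>2)"
    using assms(1-3)
  proof (induction m arbitrary: E g)
    case 0
    have "layer E (int 0) = {{}}"
      using 0 by (auto simp: layer_def dest: finite_subset)
    then show ?case by simp
  next
    case (Suc m)
    note fin = Suc.prems(3)
    define Z where "Z x = lsum a b (E - {x}) (int m) (\<lambda>_. 1)" for x
    define F where "F x = lsum a b (E - {x}) (int m) (\<lambda>S. g (insert x S))" for x
    \<comment> \<open>\<open>u x\<close> is proportional to the probability that \<open>x\<close> is
      revealed first, and \<open>y x\<close> is the mean of \<open>g\<close> given this.\<close>
    define u where "u x = a x * Z x" for x
    define y where "y x = F x / Z x" for x
    have Z: "0 \<le> Z x" for x
      unfolding Z_def using Suc.prems by (intro lsum_nonneg) auto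
    have m1: "int (Suc m) - 1 = int m" by simp
    have biased: "(\<Sum>x\<in>E. a x * lsum a b (E - {x}) (int m) (\<lambda>S. h (insert x S)))
        = real (Suc m) * lsum a b E (int (Suc m)) h" for h
      using lsum_size_biased[OF fin, where r = "int (Suc m)" and a = a and b = b and g = h]
      unfolding m1 by simp
    have F0: "F x = 0" if "x \<in> E" "Z x = 0" for x
      using lsum_total_zero[of "E - {x}" a b "int m"] that Suc.prems unfolding F_def Z_def by simp
    have step: "lsum a b (E - {x}) (int m) (\<lambda>S. exp (l * g (insert x S)))
        \<le> Z x * exp (l * y x + real m * c\<^sup>2 / 8 * l\<^sup>2)" if x: "x \<in> E" for x
    proof -
      have "swap_lipschitz c (layer (E - {x}) (int m)) (\<lambda>S. g (insert x S))"
        unfolding swap_lipschitz_def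
      proof (intro ballI impI)
        fix S T assume ST: "S \<in> layer (E - {x}) (int m)" "T \<in> layer (E - {x}) (int m)"
          and c: "card (S - T) \<le> 1" "card (T - S) \<le> 1"
        have "insert x S \<in> layer E (int (Suc m))" "insert x T \<in> layer E (int (Suc m))"
          using ST x layer_insert[of "E - {x}" x "int (Suc m)"] fin by (auto simp: insert_absorb)
        moreover have "insert x S - insert x T = S - T" "insert x T - insert x S = T - S"
          using ST by (auto simp: layer_def)
        ultimately show "\<bar>g (insert x S) - g (insert x T)\<bar> \<le> c"
          using Suc.prems(1) c by (auto simp: swap_lipschitz_def)
      qed
      from Suc.IH[OF this l] Suc.prems show ?thesis
        by (simp add: lsum_def F_def Z_def y_def)
    qed
    have hoeff: "(\<Sum>x\<in>E. u x * exp (l * y x))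
      \<le> (\<Sum>x\<in>E. u x) * exp (l * ((\<Sum>x\<in>E. u x * y x) / (\<Sum>x\<in>E. u x)) + l\<^sup>2 * c\<^sup>2 / 8)"
    proof (rule hoeffding_weights[OF fin _ l])
      show "0 \<le> u x" if "x \<in> E" for x using that Suc.prems Z by (simp add: u_def)
      fix x x' assume x: "x \<in> E" "x' \<in> E" and "0 < u x" "0 < u x'"
      \<comment> \<open>Positive weight of \<open>x\<close> and \<open>x'\<close> makes both
        quotients genuine means, so the cross-multiplied exchange inequality can be divided
        out.\<close>
      then have pos: "0 < Z x" "0 < Z x'" using Z Suc.prems(4)
        by (metis u_def less_eq_real_def mult_zero_right)+
      have "F x * Z x' \<le> (F x' + c * Z x') * Z x"
        unfolding F_def Z_def m1[symmetric]
        using Suc.prems \<open>0 \<le> c\<close> x by (intro lsum_exchange) auto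
      then show "y x \<le> y x' + c" using pos by (simp add: y_def field_simps)
    qed
    have sumu: "(\<Sum>x\<in>E. u x) = real (Suc m) * lsum a b E (int (Suc m)) (\<lambda>_. 1)"
      unfolding u_def Z_def by (rule biased)
    \<comment> \<open>If \<open>Z x = 0\<close>, then \<open>y x\<close> is 0 by the division
      convention and \<open>F x\<close> is 0 by \<open>F0\<close>, so the identity survives.\<close>
    have "u x * y x = a x * F x" if "x \<in> E" for x
      using F0[OF that] by (auto simp: u_def y_def)
    then have "(\<Sum>x\<in>E. u x * y x) = (\<Sum>x\<in>E. a x * F x)" by (intro sum.cong) auto
    also have "\<dots> = real (Suc m) * lsum a b E (int (Suc m)) g"
      unfolding F_def by (rule biased)
    finally have sumuy: "(\<Sum>x\<in>E. u x * y x) = real (Suc m) * lsum a b E (int (Suc m)) g" .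
    have "real (Suc m) * lsum a b E (int (Suc m)) (\<lambda>S. exp (l * g S))
        = (\<Sum>x\<in>E. a x * lsum a b (E - {x}) (int m) (\<lambda>S. exp (l * g (insert x S))))"
      by (rule biased[symmetric])
    also have "\<dots> \<le> (\<Sum>x\<in>E. a x * (Z x * exp (l * y x + real m * c\<^sup>2 / 8 * l\<^sup>2)))"
      by (intro sum_mono mult_left_mono step Suc.prems)
    also have "\<dots> = (\<Sum>x\<in>E. u x * exp (l * y x)) * exp (real m * c\<^sup>2 / 8 * l\<^sup>2)"
      unfolding sum_distrib_right by (intro sum.cong refl) (simp add: u_def exp_add)
    also have "\<dots> \<le> (\<Sum>x\<in>E. u x) * exp (l * ((\<Sum>x\<in>E. u x * y x) / (\<Sum>x\<in>E. u x)) + l\<^sup>2 * c\<^sup>2 / 8)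
        * exp (real m * c\<^sup>2 / 8 * l\<^sup>2)"
      by (intro mult_right_mono hoeff) simp
    also have "\<dots> = real (Suc m) * (lsum a b E (int (Suc m)) (\<lambda>_. 1)
        * exp (l * (lsum a b E (int (Suc m)) g / lsum a b E (int (Suc m)) (\<lambda>_. 1))
          + real (Suc m) * c\<^sup>2 / 8 * l\<^sup>2))"
    proof -
      have "l * k + real (Suc m) * c\<^sup>2 / 8 * l\<^sup>2 = l * k + l\<^sup>2 * c\<^sup>2 / 8 + real m * c\<^sup>2 / 8 * l\<^sup>2" for k
        by (simp add: field_simps)
      then show ?thesis unfolding sumu sumuy by (simp only: exp_add) simp
    qed
    finally have "lsum a b E (int (Suc m)) (\<lambda>S. exp (l * g S)) \<le> lsum a b E (int (Suc m)) (\<lambda>_. 1)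
        * exp (l * (lsum a b E (int (Suc m)) g / lsum a b E (int (Suc m)) (\<lambda>_. 1))
          + real (Suc m) * c\<^sup>2 / 8 * l\<^sup>2)"
      by (subst (asm) mult_le_cancel_left_pos) auto
    then show ?case by (simp add: lsum_def)
  qed
qed

text \<open>Tensorisation for uniform independent choices: average over the second component first,
  then apply the bound for the first component to the conditional mean. The two exponents add
  up.\<close>

lemma swap_concentrated_product:
  assumes fin: "finite E" "finite F" and disj: "E \<inter> F = {}"
    and sub: "\<A> \<subseteq> Pow E" "\<B> \<subseteq> Pow F"
    and A: "swap_concentrated c v \<A> (\<lambda>_. 1)" and B: "swap_concentrated c w \<B> (\<lambda>_. 1)"
  shows "swap_concentrated c (v + w) ((\<lambda>(S, T). S \<union> T) ` (\<A> \<times> \<B>)) (\<lambda>_. 1)"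
proof (cases "\<B> = {}")
  case True
  then show ?thesis by (simp add: swap_concentrated_def)
next
  case False
  have fAB: "finite \<A>" "finite \<B>" using fin sub finite_subset by blast+
  define k where "k = real (card \<B>)"
  have k: "0 < k" using False fAB by (simp add: k_def card_gt_0_iff)
  have "inj_on (\<lambda>(S, T). S \<union> T) (\<A> \<times> \<B>)"
  proof (rule inj_onI, clarify)
    fix S T S' T' assume "S \<in> \<A>" "T \<in> \<B>" "S' \<in> \<A>" "T' \<in> \<B>" "S \<union> T = S' \<union> T'"
    moreover from this have "S \<subseteq> E" "S' \<subseteq> E" "T \<subseteq> F" "T' \<subseteq> F" using sub by auto
    ultimately show "S = S' \<and> T = T'" using disj by blast
  qed
  then have sum_eq: "(\<Sum>X\<in>(\<lambda>(S, T). S \<union> T) ` (\<A> \<times> \<B>). h X) = (\<Sum>S\<in>\<A>. \<Sum>T\<in>\<B>. h (S \<union> T))"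
    for h :: "'a set \<Rightarrow> real"
    by (simp add: sum.reindex sum.cartesian_product case_prod_unfold)
  show ?thesis unfolding swap_concentrated_def sum_eq
  proof (intro allI impI)
    fix g l assume g: "swap_lipschitz c ((\<lambda>(S, T). S \<union> T) ` (\<A> \<times> \<B>)) g" and l: "0 < (l :: real)"
    have gle: "\<bar>g (S \<union> T) - g (S' \<union> T')\<bar> \<le> c"
      if m: "S \<in> \<A>" "S' \<in> \<A>" "T \<in> \<B>" "T' \<in> \<B>"
        and "card (S \<union> T - (S' \<union> T')) \<le> 1" "card (S' \<union> T' - (S \<union> T)) \<le> 1" for S S' T T'
      using g that unfolding swap_lipschitz_def by blast
    \<comment> \<open>The conditional mean of \<open>g\<close> given the first component. It keeps
      the constant \<open>c\<close>, because adding the same \<open>T\<close> to \<open>S\<close>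
      and \<open>S'\<close> cannot enlarge their differences.\<close>
    define h where "h S = (\<Sum>T\<in>\<B>. g (S \<union> T)) / k" for S
    have h: "swap_lipschitz c \<A> h" unfolding swap_lipschitz_def
    proof (intro ballI impI)
      fix S S' assume S: "S \<in> \<A>" "S' \<in> \<A>" and c: "card (S - S') \<le> 1" "card (S' - S) \<le> 1"
      have fS: "finite S" "finite S'" using S sub(1) fin(1) by (meson PowD finite_subset subsetD)+
      have "\<bar>\<Sum>T\<in>\<B>. g (S \<union> T) - g (S' \<union> T)\<bar> \<le> (\<Sum>T\<in>\<B>. \<bar>g (S \<union> T) - g (S' \<union> T)\<bar>)"
        by (rule sum_abs)
      also have "\<dots> \<le> (\<Sum>T\<in>\<B>. c)"
      proof (intro sum_mono gle S)
        fix T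
        have "card (S \<union> T - (S' \<union> T)) \<le> card (S - S')" "card (S' \<union> T - (S \<union> T)) \<le> card (S' - S)"
          using fS by (auto intro!: card_mono)
        then show "card (S \<union> T - (S' \<union> T)) \<le> 1" "card (S' \<union> T - (S \<union> T)) \<le> 1"
          using c by simp_all
      qed
      finally have "\<bar>(\<Sum>T\<in>\<B>. g (S \<union> T)) - (\<Sum>T\<in>\<B>. g (S' \<union> T))\<bar> \<le> k * c"
        by (simp add: sum_subtractf k_def)
      then show "\<bar>h S - h S'\<bar> \<le> c"
        using k by (simp add: h_def field_simps flip: diff_divide_distrib)
    qed
    have inner: "(\<Sum>T\<in>\<B>. exp (l * g (S \<union> T))) \<le> k * exp (l * h S + w * l\<^sup>2)" if S: "S \<in> \<A>" for S
    proof -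
      have "swap_lipschitz c \<B> (\<lambda>T. g (S \<union> T))" unfolding swap_lipschitz_def
      proof (intro ballI impI gle S)
        fix T T' assume T: "T \<in> \<B>" "T' \<in> \<B>" and c: "card (T - T') \<le> 1" "card (T' - T) \<le> 1"
        have fT: "finite T" "finite T'" using T sub(2) fin(2) by (meson PowD finite_subset subsetD)+
        have "card (S \<union> T - (S \<union> T')) \<le> card (T - T')" "card (S \<union> T' - (S \<union> T)) \<le> card (T' - T)"
          using fT by (auto intro!: card_mono)
        then show "card (S \<union> T - (S \<union> T')) \<le> 1" "card (S \<union> T' - (S \<union> T)) \<le> 1"
          using c by simp_all
      qed
      then show ?thesis
        using B l unfolding swap_concentrated_def by (auto simp: h_def k_def)
    qed
    have outer: "(\<Sum>S\<in>\<A>. exp (l * h S)) \<le> card \<A> * exp (l * ((\<Sum>S\<in>\<A>. h S) / card \<A>) + v * l\<^sup>2)"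
      using A h l unfolding swap_concentrated_def by simp
    have "(\<Sum>S\<in>\<A>. \<Sum>T\<in>\<B>. 1 * exp (l * g (S \<union> T))) \<le> (\<Sum>S\<in>\<A>. k * exp (l * h S + w * l\<^sup>2))"
      using inner by (intro sum_mono) auto
    also have "\<dots> = k * exp (w * l\<^sup>2) * (\<Sum>S\<in>\<A>. exp (l * h S))"
      unfolding sum_distrib_left by (intro sum.cong refl) (simp add: exp_add)
    also have "\<dots> \<le> k * exp (w * l\<^sup>2) * (card \<A> * exp (l * ((\<Sum>S\<in>\<A>. h S) / card \<A>) + v * l\<^sup>2))"
      using outer k by (intro mult_left_mono) auto
    also have "\<dots> = (card \<A> * k) * exp (l * ((\<Sum>S\<in>\<A>. h S) / card \<A>) + (v + w) * l\<^sup>2)"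
      by (simp add: exp_add algebra_simps)
    also have "(\<Sum>S\<in>\<A>. h S) / card \<A> = (\<Sum>S\<in>\<A>. \<Sum>T\<in>\<B>. 1 * g (S \<union> T)) / (card \<A> * k)"
      by (simp add: h_def flip: sum_divide_distrib)
    finally show "(\<Sum>S\<in>\<A>. \<Sum>T\<in>\<B>. 1 * exp (l * g (S \<union> T)))
      \<le> (\<Sum>S\<in>\<A>. \<Sum>T\<in>\<B>. 1) * exp (l * ((\<Sum>S\<in>\<A>. \<Sum>T\<in>\<B>. 1 * g (S \<union> T)) / (\<Sum>S\<in>\<A>. \<Sum>T\<in>\<B>. 1)) + (v + w) * l\<^sup>2)"
      by (simp add: k_def)
  qed
qed

lemma swap_lipschitz_uminus: "swap_lipschitz c \<B> g \<Longrightarrow> swap_lipschitz c \<B> (\<lambda>S. - g S)"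
  unfolding swap_lipschitz_def by (simp add: abs_minus_commute)

section \<open>From exponential moments to tails\<close>

lemma swap_concentrated_upper_tail:
  assumes fin: "finite \<B>" and W: "\<And>S. S \<in> \<B> \<Longrightarrow> 0 \<le> W S"
    and conc: "swap_concentrated c v \<B> W" and lip: "swap_lipschitz c \<B> g"
    and "0 \<le> v" and "0 < t"
  shows "(\<Sum>S | S \<in> \<B> \<and> t \<le> g S - (\<Sum>S\<in>\<B>. W S * g S) / (\<Sum>S\<in>\<B>. W S). W S)
    \<le> gauss_tail t (4 * v) / 2 * (\<Sum>S\<in>\<B>. W S)"
proof -
  define Z where "Z = (\<Sum>S\<in>\<B>. W S)"
  define \<mu> where "\<mu> = (\<Sum>S\<in>\<B>. W S * g S) / Z"
  define X where "X = (\<Sum>S | S \<in> \<B> \<and> t \<le> g S - \<mu>. W S)"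
  have Z: "0 \<le> Z" unfolding Z_def using W by (rule sum_nonneg)
  have chernoff: "X \<le> Z * exp (v * l\<^sup>2 - l * t)" if l: "0 < l" for l
  proof -
    have "X \<le> (\<Sum>S | S \<in> \<B> \<and> t \<le> g S - \<mu>. W S * exp (l * (g S - \<mu> - t)))"
      unfolding X_def
    proof (intro sum_mono)
      fix S assume "S \<in> {S \<in> \<B>. t \<le> g S - \<mu>}"
      then have "W S * 1 \<le> W S * exp (l * (g S - \<mu> - t))"
        using l W by (intro mult_left_mono) auto
      then show "W S \<le> W S * exp (l * (g S - \<mu> - t))" by simp
    qed
    also have "\<dots> \<le> (\<Sum>S\<in>\<B>. W S * exp (l * (g S - \<mu> - t)))"
      using fin W by (intro sum_mono2) auto
    also have "\<dots> = (\<Sum>S\<in>\<B>. W S * exp (l * g S)) * exp (- (l * \<mu>) - l * t)"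
      unfolding sum_distrib_right
      by (intro sum.cong refl) (simp add: algebra_simps flip: exp_add)
    also have "\<dots> \<le> (Z * exp (l * \<mu> + v * l\<^sup>2)) * exp (- (l * \<mu>) - l * t)"
      using conc lip l unfolding swap_concentrated_def Z_def \<mu>_def by (intro mult_right_mono) auto
    also have "\<dots> = Z * exp (v * l\<^sup>2 - l * t)"
      by (simp add: algebra_simps flip: exp_add)
    finally show ?thesis .
  qed
  have "X \<le> gauss_tail t (4 * v) / 2 * Z"
  proof (cases "v = 0")
    case True
    have "X \<le> 0"
    proof (rule ccontr)
      assume "\<not> X \<le> 0"
      then have X: "0 < X" by simp
      have "X \<le> Z" using chernoff[of 1] Z \<open>0 < t\<close> True mult_left_mono[of "exp (- t)" 1 Z] by simp
      then have "0 < Z" using X by simp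
      \<comment> \<open>For \<open>v = 0\<close> the bound decays in \<open>l\<close> without limit.
        Instead of a limit, \<open>l = Z / (X * t)\<close> is inserted; it contradicts
        \<open>exp s > s\<close> at \<open>s = Z / X\<close>.\<close>
      then have "X \<le> Z * exp (- (Z / X))"
        using chernoff[of "Z / (X * t)"] X \<open>0 < t\<close> True by simp
      then have "X * exp (Z / X) \<le> Z" by (simp add: exp_minus field_simps)
      moreover have "Z / X < exp (Z / X)" using exp_ge_add_one_self[of "Z / X"] by linarith
      ultimately show False using X by (simp add: field_simps)
    qed
    then show ?thesis using True \<open>0 < t\<close> by (simp add: gauss_tail_def)
  next
    case False
    then have v: "0 < v" using \<open>0 \<le> v\<close> by simp
    \<comment> \<open>\<open>t / (2 * v)\<close> minimises
      \<open>v * l\<^sup>2 - l * t\<close>.\<close>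
    have e: "v * (t / (2 * v))\<^sup>2 - t / (2 * v) * t = - (t\<^sup>2 / (4 * v))"
      using v by (simp add: field_simps power2_eq_square)
    have "X \<le> Z * exp (v * (t / (2 * v))\<^sup>2 - t / (2 * v) * t)"
      using v \<open>0 < t\<close> by (intro chernoff) simp
    then show ?thesis unfolding e using v by (simp add: gauss_tail_def mult.commute)
  qed
  then show ?thesis unfolding X_def \<mu>_def Z_def .
qed

lemma swap_concentrated_tail:
  assumes fin: "finite \<B>" and W: "\<And>S. S \<in> \<B> \<Longrightarrow> 0 \<le> W S"
    and conc: "swap_concentrated c v \<B> W" and lip: "swap_lipschitz c \<B> g"
    and "0 \<le> v" and "0 \<le> t"
  shows "(\<Sum>S | S \<in> \<B> \<and> t \<le> \<bar>g S - (\<Sum>S\<in>\<B>. W S * g S) / (\<Sum>S\<in>\<B>. W S)\<bar>. W S)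
    \<le> gauss_tail t (4 * v) * (\<Sum>S\<in>\<B>. W S)"
proof (cases "t = 0")
  \<comment> \<open>At \<open>t = 0\<close> the claimed bound is twice the total mass.\<close>
  case True
  have "0 \<le> (\<Sum>S\<in>\<B>. W S)" using W by (rule sum_nonneg)
  moreover have "(\<Sum>S | S \<in> \<B> \<and> t \<le> \<bar>g S - (\<Sum>S\<in>\<B>. W S * g S) / (\<Sum>S\<in>\<B>. W S)\<bar>. W S) \<le> (\<Sum>S\<in>\<B>. W S)"
    using fin W by (intro sum_mono2) auto
  ultimately show ?thesis using True by (simp add: gauss_tail_def)
next
  case False
  then have t: "0 < t" using \<open>0 \<le> t\<close> by simp
  define \<mu> where "\<mu> = (\<Sum>S\<in>\<B>. W S * g S) / (\<Sum>S\<in>\<B>. W S)"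
  have "(\<Sum>S | S \<in> \<B> \<and> t \<le> \<bar>g S - \<mu>\<bar>. W S)
    \<le> (\<Sum>S\<in>{S \<in> \<B>. t \<le> g S - \<mu>} \<union> {S \<in> \<B>. t \<le> - g S - - \<mu>}. W S)"
    using fin W by (intro sum_mono2) auto
  also have "\<dots> \<le> (\<Sum>S | S \<in> \<B> \<and> t \<le> g S - \<mu>. W S) + (\<Sum>S | S \<in> \<B> \<and> t \<le> - g S - - \<mu>. W S)"
  proof -
    have "0 \<le> sum W ({S \<in> \<B>. t \<le> g S - \<mu>} \<inter> {S \<in> \<B>. t \<le> - g S - - \<mu>})"
      using W by (intro sum_nonneg) auto
    then show ?thesis using fin by (subst sum_Un) (linarith | simp)+
  qed
  also have "\<dots> \<le> gauss_tail t (4 * v) / 2 * (\<Sum>S\<in>\<B>. W S) + gauss_tail t (4 * v) / 2 * (\<Sum>S\<in>\<B>. W S)"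
    using swap_concentrated_upper_tail[OF fin W conc lip \<open>0 \<le> v\<close> t]
      swap_concentrated_upper_tail[OF fin W conc swap_lipschitz_uminus[OF lip] \<open>0 \<le> v\<close> t]
    unfolding \<mu>_def by (intro add_mono) (simp_all add: sum_negf)
  finally show ?thesis unfolding \<mu>_def by (simp add: mult.commute)
qed

lemma gauss_tail_mono4: "0 \<le> s \<Longrightarrow> gauss_tail t s \<le> gauss_tail t (4 * s)"
  by (cases "s = 0") (auto simp: gauss_tail_def frac_le)

section \<open>The law of the arcs given the vertex history\<close>

definition random_subset :: "'a set \<Rightarrow> ('a \<Rightarrow> real) \<Rightarrow> 'a set pmf" where
  "random_subset E q = map_pmf Collect (Pi_pmf E False (\<lambda>e. bernoulli_pmf (q e)))"

lemma random_subset_cong: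
  "E = E' \<Longrightarrow> (\<And>e. e \<in> E' \<Longrightarrow> q e = q' e) \<Longrightarrow> random_subset E q = random_subset E' q'"
  unfolding random_subset_def by (intro arg_cong2[where f = map_pmf] Pi_pmf_cong) auto

lemma set_random_subset:
  "finite E \<Longrightarrow> set_pmf (random_subset E q) \<subseteq> Pow E"
  using set_Pi_pmf_subset[of E False "\<lambda>e. bernoulli_pmf (q e)"] by (auto simp: random_subset_def)

lemma pmf_random_subset:
  assumes "finite E" "\<And>e. e \<in> E \<Longrightarrow> 0 \<le> q e" "\<And>e. e \<in> E \<Longrightarrow> q e \<le> 1"
  shows "pmf (random_subset E q) S = (if S \<subseteq> E then wt q (\<lambda>e. 1 - q e) E S else 0)"
proof -
  have "inj Collect" by (auto simp: inj_on_def)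
  then have "pmf (random_subset E q) (Collect (\<lambda>x. x \<in> S))
      = pmf (Pi_pmf E False (\<lambda>e. bernoulli_pmf (q e))) (\<lambda>x. x \<in> S)"
    unfolding random_subset_def by (rule pmf_map_inj')
  also have "\<dots> = (if S \<subseteq> E then \<Prod>e\<in>E. if e \<in> S then q e else 1 - q e else 0)"
    using assms by (auto simp: pmf_Pi intro!: prod.cong)
  also have "\<dots> = (if S \<subseteq> E then wt q (\<lambda>e. 1 - q e) E S else 0)"
    using assms(1) by (simp add: wt_def prod.If_cases Int_absorb1 Diff_eq Compl_eq)
  finally show ?thesis by simp
qed

text \<open>The effect of a vertex removal: decisions about its arcs are forgotten and the others
  stay independent.\<close>

lemma random_subset_Int:
  assumes "finite E" "E' \<subseteq> E"
  shows "map_pmf (\<lambda>S. S \<inter> E') (random_subset E q) = random_subset E' q"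
  unfolding random_subset_def Pi_pmf_subset[OF assms]
  by (auto simp: pmf.map_comp intro!: map_pmf_cong)

text \<open>The effect of a vertex arrival: decisions about its arcs are independent of all earlier
  ones.\<close>

lemma random_subset_Un:
  assumes "finite A" "finite B" "A \<inter> B = {}"
  shows "random_subset (A \<union> B) q
    = map_pmf (\<lambda>(S, T). S \<union> T) (pair_pmf (random_subset A q) (random_subset B q))"
proof -
  let ?p = "\<lambda>E. Pi_pmf E False (\<lambda>e. bernoulli_pmf (q e))"
  have "random_subset (A \<union> B) q
    = map_pmf (\<lambda>(f, g). {x. if x \<in> A then f x else g x}) (pair_pmf (?p A) (?p B))"
    unfolding random_subset_def Pi_pmf_union[OF assms] pmf.map_comp
    by (intro map_pmf_cong refl) (simp add: case_prod_unfold)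
  also have "\<dots> = map_pmf (\<lambda>(f, g). Collect f \<union> Collect g) (pair_pmf (?p A) (?p B))"
  proof (intro map_pmf_cong refl)
    fix z assume "z \<in> set_pmf (pair_pmf (?p A) (?p B))"
    then have z: "fst z \<in> set_pmf (?p A)" "snd z \<in> set_pmf (?p B)"
      by (simp_all only: set_pair_pmf mem_Times_iff)
    have "\<forall>x. x \<notin> A \<longrightarrow> \<not> fst z x" "\<forall>x. x \<notin> B \<longrightarrow> \<not> snd z x"
      using subsetD[OF set_Pi_pmf_subset[OF assms(1)] z(1)]
        subsetD[OF set_Pi_pmf_subset[OF assms(2)] z(2)] by simp_all
    then show "(case z of (f, g) \<Rightarrow> {x. if x \<in> A then f x else g x})
        = (case z of (f, g) \<Rightarrow> Collect f \<union> Collect g)"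
      using assms(3) by (auto simp: case_prod_unfold)
  qed
  also have "\<dots> = map_pmf (\<lambda>(S, T). S \<union> T) (pair_pmf (random_subset A q) (random_subset B q))"
    unfolding random_subset_def map_pair[symmetric] pmf.map_comp
    by (intro map_pmf_cong refl) (simp add: case_prod_unfold)
  finally show ?thesis .
qed

lemma pmf_map_unique:
  assumes "\<And>a. a \<in> set_pmf P \<Longrightarrow> f a = s \<longleftrightarrow> a = a\<^sub>0"
  shows "pmf (map_pmf f P) s = pmf P a\<^sub>0"
proof -
  have "pmf (map_pmf f P) s = measure_pmf.prob P (f -` {s})" by (rule pmf_map)
  also have "\<dots> = measure_pmf.prob P {a\<^sub>0}"
    by (intro measure_pmf.finite_measure_eq_AE) (use assms in \<open>auto simp: AE_measure_pmf_iff\<close>)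
  finally show ?thesis by (simp add: measure_pmf_single)
qed

lemma wt_image:
  assumes "inj_on h E" "S \<subseteq> E"
  shows "wt a b (h ` E) (h ` S) = wt (a \<circ> h) (b \<circ> h) E S"
proof -
  have "h ` E - h ` S = h ` (E - S)" using assms by (simp add: inj_on_image_set_diff)
  moreover have "inj_on h S" "inj_on h (E - S)" using assms by (auto intro: inj_on_subset)
  ultimately show ?thesis by (simp add: wt_def prod.reindex o_def)
qed

text \<open>Turns decisions about old vertices \<open>i\<close> into decisions about the arcs
  \<open>(n, i)\<close> of the new vertex \<open>n\<close>.\<close>

lemma random_subset_image:
  assumes E: "finite E" "inj_on h E" and q: "\<And>e. e \<in> E \<Longrightarrow> 0 \<le> q (h e)" "\<And>e. e \<in> E \<Longrightarrow> q (h e) \<le> 1"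
  shows "random_subset (h ` E) q = map_pmf ((`) h) (random_subset E (q \<circ> h))"
proof (rule pmf_eqI)
  fix S
  have hE: "pmf (random_subset (h ` E) q) S = (if S \<subseteq> h ` E then wt q (\<lambda>e. 1 - q e) (h ` E) S else 0)"
    using E q by (intro pmf_random_subset) auto
  have sub: "T \<subseteq> E" if "T \<in> set_pmf (random_subset E (q \<circ> h))" for T
    using set_random_subset[OF E(1)] that by auto
  show "pmf (random_subset (h ` E) q) S = pmf (map_pmf ((`) h) (random_subset E (q \<circ> h))) S"
  proof (cases "S \<subseteq> h ` E")
    case True
    then obtain T where T: "T \<subseteq> E" "S = h ` T" by (meson subset_imageE)
    have "pmf (map_pmf ((`) h) (random_subset E (q \<circ> h))) S = pmf (random_subset E (q \<circ> h)) T"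
    proof (rule pmf_map_unique)
      fix a assume "a \<in> set_pmf (random_subset E (q \<circ> h))"
      then show "h ` a = S \<longleftrightarrow> a = T"
        using inj_on_image_eq_iff[OF E(2) sub T(1)] T(2) by simp
    qed
    also have "\<dots> = wt (q \<circ> h) (\<lambda>e. 1 - (q \<circ> h) e) E T"
      using E q T by (subst pmf_random_subset) auto
    also have "\<dots> = wt q (\<lambda>e. 1 - q e) (h ` E) S"
      unfolding T(2) wt_image[OF E(2) T(1)] by (simp add: o_def)
    finally show ?thesis using hE True by simp
  next
    case False
    then have "S \<notin> set_pmf (map_pmf ((`) h) (random_subset E (q \<circ> h)))" using sub by auto
    then have "pmf (map_pmf ((`) h) (random_subset E (q \<circ> h))) S = 0" by (meson set_pmf_iff)
    then show ?thesis using hE False by simp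
  qed
qed

section \<open>The chain of vertex histories and present arcs\<close>

definition arcs_on :: "nat set \<Rightarrow> (nat \<times> nat) set" where
  "arcs_on V = {(j, i). i \<in> V \<and> j \<in> V \<and> i < j}"

text \<open>A vertex \<open>j\<close> is born at step \<open>j\<close>, and position 0 of the
  history \<open>h\<close> is the initial vertex set, so \<open>h ! (j - 1)\<close> is the set of
  vertices to which \<open>j\<close> could connect.\<close>

definition arc_prob :: "real \<Rightarrow> nat set list \<Rightarrow> nat \<times> nat \<Rightarrow> real" where
  "arc_prob \<beta> h e = min (\<beta> / real (card (h ! (fst e - 1)))) 1"

definition valid_graph :: "nat \<Rightarrow> ugraph \<Rightarrow> bool" where
  "valid_graph n g \<longleftrightarrow> vertices g \<subseteq> {1..n} \<and>
     edges g \<subseteq> {{i, j} | i j. i \<in> vertices g \<and> j \<in> vertices g \<and> i < j}"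

lemma finite_arcs_on: "finite V \<Longrightarrow> finite (arcs_on V)"
  by (rule finite_subset[of _ "V \<times> V"]) (auto simp: arcs_on_def)

lemma arc_prob_bounds: "0 < \<beta> \<Longrightarrow> 0 \<le> arc_prob \<beta> h e" "arc_prob \<beta> h e \<le> 1"
  by (auto simp: arc_prob_def)

lemma valid_graph_add_vertex:
  assumes "valid_graph n g" "g' \<in> set_pmf (add_vertex \<beta> (Suc n) g)"
  shows "valid_graph (Suc n) g'"
proof -
  obtain a where g': "g' = (vertices g \<union> {Suc n}, edges g \<union> {{i, Suc n} | i. i \<in> vertices g \<and> a i})"
    using assms(2) by (auto simp: add_vertex_def)
  have "\<exists>i j. e = {i, j} \<and> i \<in> vertices g' \<and> j \<in> vertices g' \<and> i < j" if e: "e \<in> edges g'" for e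
  proof -
    consider "e \<in> edges g" | i where "e = {i, Suc n}" "i \<in> vertices g" using e g' by auto
    then show ?thesis
    proof cases
      case 1
      then obtain i j where "e = {i, j}" "i \<in> vertices g" "j \<in> vertices g" "i < j"
        using assms(1) unfolding valid_graph_def by blast
      then show ?thesis using g' by auto
    next
      case 2
      then have "i < Suc n" using assms(1) by (auto simp: valid_graph_def)
      then show ?thesis using 2 g' by auto
    qed
  qed
  moreover have "vertices g' \<subseteq> {1..Suc n}" using assms(1) g' by (auto simp: valid_graph_def)
  ultimately show ?thesis unfolding valid_graph_def by blast
qed

lemma valid_graph_remove_vertex:
  assumes "valid_graph n g" "g' \<in> set_pmf (remove_vertex g)"
  shows "valid_graph (Suc n) g'"
proof (cases "vertices g = {}")
  case True
  then show ?thesis using assms by (auto simp: remove_vertex_def valid_graph_def)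
next
  case False
  have "finite (vertices g)" using assms(1) finite_subset by (auto simp: valid_graph_def)
  with False obtain v where "g' = (vertices g - {v}, {e \<in> edges g. v \<notin> e})"
    using assms(2) by (auto simp: remove_vertex_def)
  then have g': "vertices g' = vertices g - {v}" "edges g' = {e \<in> edges g. v \<notin> e}" by simp_all
  have "\<exists>i j. e = {i, j} \<and> i \<in> vertices g' \<and> j \<in> vertices g' \<and> i < j" if "e \<in> edges g'" for e
  proof -
    have e: "e \<in> edges g" "v \<notin> e" using that g' by auto
    then obtain i j where "e = {i, j}" "i \<in> vertices g" "j \<in> vertices g" "i < j"
      using assms(1) unfolding valid_graph_def by blast
    then show ?thesis using e g' by auto
  qed
  moreover have "vertices g' \<subseteq> {1..Suc n}" using assms(1) g' by (auto simp: valid_graph_def)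
  ultimately show ?thesis unfolding valid_graph_def by blast
qed

lemma drgvr_history_valid:
  assumes "gs \<in> set_pmf (drgvr_history \<beta> \<epsilon> n)"
  shows "length gs = Suc n \<and> hd gs = ({}, {}) \<and> (\<forall>k\<le>n. valid_graph k (gs ! k))"
  using assms
proof (induction n arbitrary: gs)
  case 0
  then show ?case by (simp add: valid_graph_def)
next
  case (Suc n)
  then obtain hs g where hs: "hs \<in> set_pmf (drgvr_history \<beta> \<epsilon> n)" "gs = hs @ [g]"
    and g: "g \<in> set_pmf (drgvr_step \<beta> \<epsilon> (Suc n) (last hs))" by auto
  note IH = Suc.IH[OF hs(1)]
  then have "hs \<noteq> []" by auto
  with IH have val: "valid_graph n (last hs)" by (simp add: last_conv_nth)
  obtain \<xi> where "g \<in> set_pmf (if \<xi> then add_vertex \<beta> (Suc n) (last hs) else remove_vertex (last hs))"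
    using g by (auto simp: drgvr_step_def)
  then have "valid_graph (Suc n) g"
    using valid_graph_add_vertex[OF val] valid_graph_remove_vertex[OF val] by (metis (full_types))
  then show ?case using IH \<open>hs \<noteq> []\<close> by (auto simp: hs(2) nth_append le_Suc_eq)
qed

lemma drgvr_history_last_valid:
  assumes "gs \<in> set_pmf (drgvr_history \<beta> \<epsilon> n)"
  shows "gs \<noteq> []" "valid_graph n (last gs)"
proof -
  have len: "length gs = Suc n" and val: "valid_graph n (gs ! n)"
    using drgvr_history_valid[OF assms] by auto
  from len show "gs \<noteq> []" by auto
  then show "valid_graph n (last gs)" using len val by (simp add: last_conv_nth)
qed

lemma finite_drgvr_history: "finite (set_pmf (drgvr_history \<beta> \<epsilon> n))"
proof (rule finite_subset)
  let ?V = "Pow {1..n} \<times> Pow (Pow {1..n})"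
  show "set_pmf (drgvr_history \<beta> \<epsilon> n) \<subseteq> {gs. set gs \<subseteq> ?V \<and> length gs = Suc n}"
  proof
    fix gs assume "gs \<in> set_pmf (drgvr_history \<beta> \<epsilon> n)"
    then have len: "length gs = Suc n" and val: "\<And>k. k \<le> n \<Longrightarrow> valid_graph k (gs ! k)"
      using drgvr_history_valid by auto
    have "g \<in> ?V" if g: "g \<in> set gs" for g
    proof -
      obtain k where "k \<le> n" "g = gs ! k" using g len by (metis in_set_conv_nth less_Suc_eq_le)
      then have "valid_graph n g" using val[of k] by (fastforce simp: valid_graph_def)
      then have "vertices g \<subseteq> {1..n}" "edges g \<subseteq> Pow {1..n}" by (fastforce simp: valid_graph_def)+
      then show ?thesis by (cases g) auto
    qed
    then show "gs \<in> {gs. set gs \<subseteq> ?V \<and> length gs = Suc n}" using len by auto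
  qed
  show "finite {gs. set gs \<subseteq> ?V \<and> length gs = Suc n}" by (intro finite_lists_length_eq) simp
qed

lemma parcs_orient_subset:
  assumes "valid_graph n g" shows "parcs (orient g) \<subseteq> arcs_on (vertices g)"
proof clarify
  fix j i assume "(j, i) \<in> parcs (orient g)"
  then have ij: "i < j" "{i, j} \<in> edges g" by (simp_all add: orient_def)
  then obtain i' j' where "{i, j} = {i', j'}" "i' \<in> vertices g" "j' \<in> vertices g"
    using assms unfolding valid_graph_def by blast
  then have "i \<in> vertices g" "j \<in> vertices g" by (metis doubleton_eq_iff)+
  then show "(j, i) \<in> arcs_on (vertices g)" using ij by (simp add: arcs_on_def)
qed

lemma card_parcs_orient:
  assumes "valid_graph n g" shows "card (parcs (orient g)) = card (edges g)"
proof -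
  have "inj_on (\<lambda>(j, i). {i, j}) (parcs (orient g))"
  proof (rule inj_onI, clarify)
    fix j i j' i' assume "(j, i) \<in> parcs (orient g)" "(j', i') \<in> parcs (orient g)"
      and eq: "{i, j} = {i', j'}"
    then have "i < j" "i' < j'" by (simp_all add: orient_def)
    then show "j = j' \<and> i = i'" using eq by (metis doubleton_eq_iff less_asym)
  qed
  moreover have "(\<lambda>(j, i). {i, j}) ` parcs (orient g) = edges g"
  proof (intro equalityI subsetI)
    fix e assume e: "e \<in> edges g"
    then obtain i j where "e = {i, j}" "i < j" using assms unfolding valid_graph_def by blast
    then have "(j, i) \<in> parcs (orient g)" using e by (simp add: orient_def)
    then show "e \<in> (\<lambda>(j, i). {i, j}) ` parcs (orient g)"
      using \<open>e = {i, j}\<close> by (auto intro: rev_image_eqI)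
  qed (auto simp: orient_def)
  ultimately show ?thesis by (metis card_image)
qed

text \<open>Past edges are dropped: the vertex history and the present arcs already form a Markov
  chain and determine both conditioning variables.\<close>

definition arc_state :: "ugraph list \<Rightarrow> nat set list \<times> (nat \<times> nat) set" where
  "arc_state gs = (map vertices gs, parcs (orient (last gs)))"

definition arc_kernel :: "real \<Rightarrow> nat \<Rightarrow> nat set list \<Rightarrow> (nat \<times> nat) set \<Rightarrow> bool
    \<Rightarrow> (nat set list \<times> (nat \<times> nat) set) pmf" where
  "arc_kernel \<beta> n h A \<xi> =
     (if \<xi> then map_pmf (\<lambda>B. (h @ [last h \<union> {n}], A \<union> Pair n ` B))
                (random_subset (last h) (\<lambda>_. min (\<beta> / real (card (last h))) 1))
      else if last h = {} then return_pmf (h @ [{}], A)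
      else map_pmf (\<lambda>v. (h @ [last h - {v}], A \<inter> arcs_on (last h - {v}))) (pmf_of_set (last h)))"

lemma arc_state_step:
  assumes gs: "gs \<noteq> []" and val: "valid_graph n (last gs)"
  shows "map_pmf (\<lambda>g. arc_state (gs @ [g])) (drgvr_step \<beta> \<epsilon> (Suc n) (last gs))
    = bind_pmf (bernoulli_pmf (1/2 + \<epsilon>)) (arc_kernel \<beta> (Suc n) (fst (arc_state gs)) (snd (arc_state gs)))"
proof -
  define V where "V = vertices (last gs)"
  define E where "E = edges (last gs)"
  define A where "A = parcs (orient (last gs))"
  define h where "h = map vertices gs"
  have g: "last gs = (V, E)" by (simp add: V_def E_def)
  have hV: "last h = V" using gs by (simp add: h_def V_def last_map)
  have V: "V \<subseteq> {1..n}" "finite V" using val by (auto simp: valid_graph_def V_def intro: finite_subset)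
  have AV: "A \<subseteq> arcs_on V" unfolding A_def V_def by (rule parcs_orient_subset[OF val])
  have A: "A = {(j, i). i < j \<and> {i, j} \<in> E}" by (simp add: A_def orient_def E_def)
  \<comment> \<open>All old labels are below \<open>Suc n\<close>, so each new edge is oriented away
    from the new vertex. The default value \<open>False\<close> of the product law keeps
    \<open>Collect a\<close> inside \<open>V\<close>.\<close>
  have add: "parcs (orient (V \<union> {Suc n}, E \<union> {{i, Suc n} | i. i \<in> V \<and> a i}))
      = A \<union> Pair (Suc n) ` Collect a" if "\<forall>x. x \<notin> V \<longrightarrow> a x = False" for a
    using that V by (auto simp: A orient_def doubleton_eq_iff)
  have rem: "parcs (orient (V - {v}, {e \<in> E. v \<notin> e})) = A \<inter> arcs_on (V - {v})" for v
    using AV by (auto simp: A orient_def arcs_on_def)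
  have "map_pmf (\<lambda>g. arc_state (gs @ [g])) (if \<xi> then add_vertex \<beta> (Suc n) (last gs) else remove_vertex (last gs))
      = arc_kernel \<beta> (Suc n) h A \<xi>" for \<xi>
  proof (cases \<xi>)
    case True
    have "map_pmf (\<lambda>g. arc_state (gs @ [g])) (add_vertex \<beta> (Suc n) (last gs))
      = map_pmf (\<lambda>a. (h @ [V \<union> {Suc n}], A \<union> Pair (Suc n) ` Collect a))
          (Pi_pmf V False (\<lambda>_. bernoulli_pmf (min (\<beta> / real (card V)) 1)))"
      unfolding add_vertex_def g pmf.map_comp
    proof (intro map_pmf_cong)
      fix a assume "a \<in> set_pmf (Pi_pmf V False (\<lambda>_. bernoulli_pmf (min (\<beta> / real (card V)) 1)))"
      from subsetD[OF set_Pi_pmf_subset[OF V(2)] this]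
      have "\<forall>x. x \<notin> V \<longrightarrow> a x = False" by simp
      from add[OF this]
      show "((\<lambda>g. arc_state (gs @ [g])) \<circ> (\<lambda>a. (vertices (V, E) \<union> {Suc n},
            edges (V, E) \<union> {{i, Suc n} | i. i \<in> vertices (V, E) \<and> a i}))) a
          = (h @ [V \<union> {Suc n}], A \<union> Pair (Suc n) ` Collect a)"
        by (simp add: arc_state_def h_def)
    qed simp
    then show ?thesis using True
      by (simp add: arc_kernel_def random_subset_def hV pmf.map_comp o_def)
  next
    case False
    then show ?thesis
      unfolding remove_vertex_def arc_kernel_def hV g
      by (auto simp: arc_state_def h_def pmf.map_comp o_def rem A_def g intro!: map_pmf_cong)
  qed
  then show ?thesis
    by (simp add: drgvr_step_def map_bind_pmf arc_state_def flip: h_def A_def)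
qed

text \<open>Vertex moves never look at the arcs, so independence of the arcs given the history is
  preserved at each step. The support conditions on \<open>H\<close> make \<open>Suc n\<close> a
  fresh label and keep the indices used by \<open>arc_prob\<close> inside the list.\<close>

lemma arc_state_law:
  assumes "0 < \<beta>"
  shows "\<exists>H. (\<forall>h\<in>set_pmf H. length h = Suc n \<and> last h \<subseteq> {1..n}) \<and>
    map_pmf arc_state (drgvr_history \<beta> \<epsilon> n)
      = bind_pmf H (\<lambda>h. map_pmf (Pair h) (random_subset (arcs_on (last h)) (arc_prob \<beta> h)))"
proof (induction n)
  case 0
  have "arcs_on {} = {}" by (simp add: arcs_on_def)
  then have "map_pmf arc_state (drgvr_history \<beta> \<epsilon> 0) = bind_pmf (return_pmf [{}])
      (\<lambda>h. map_pmf (Pair h) (random_subset (arcs_on (last h)) (arc_prob \<beta> h)))"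
    by (simp add: bind_return_pmf random_subset_def arc_state_def orient_def)
  then show ?case by (intro exI[of _ "return_pmf [{}]"]) simp
next
  case (Suc n)
  then obtain H where H: "\<And>h. h \<in> set_pmf H \<Longrightarrow> length h = Suc n \<and> last h \<subseteq> {1..n}"
    and law: "map_pmf arc_state (drgvr_history \<beta> \<epsilon> n)
      = bind_pmf H (\<lambda>h. map_pmf (Pair h) (random_subset (arcs_on (last h)) (arc_prob \<beta> h)))" by blast
  define b where "b = bernoulli_pmf (1/2 + \<epsilon>)"
  define R where "R h = random_subset (arcs_on (last h)) (arc_prob \<beta> h)" for h
  define v where "v h \<xi> = (if \<xi> then return_pmf (h @ [last h \<union> {Suc n}])
      else if last h = {} then return_pmf (h @ [{}])
      else map_pmf (\<lambda>v. h @ [last h - {v}]) (pmf_of_set (last h)))" for h :: "nat set list" and \<xi>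
  have "map_pmf arc_state (drgvr_history \<beta> \<epsilon> (Suc n))
    = bind_pmf (drgvr_history \<beta> \<epsilon> n) (\<lambda>gs. map_pmf (\<lambda>g. arc_state (gs @ [g])) (drgvr_step \<beta> \<epsilon> (Suc n) (last gs)))"
    by (simp add: map_bind_pmf pmf.map_comp o_def)
  also have "\<dots> = bind_pmf (drgvr_history \<beta> \<epsilon> n)
      (\<lambda>gs. bind_pmf b (arc_kernel \<beta> (Suc n) (fst (arc_state gs)) (snd (arc_state gs))))"
    unfolding b_def by (intro bind_pmf_cong refl arc_state_step drgvr_history_last_valid)
  also have "\<dots> = bind_pmf (map_pmf arc_state (drgvr_history \<beta> \<epsilon> n))
      (\<lambda>(h, A). bind_pmf b (arc_kernel \<beta> (Suc n) h A))"
    by (simp add: bind_map_pmf case_prod_unfold)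
  also have "\<dots> = bind_pmf H (\<lambda>h. bind_pmf (R h) (\<lambda>A. bind_pmf b (arc_kernel \<beta> (Suc n) h A)))"
    unfolding law by (simp add: bind_assoc_pmf bind_map_pmf R_def)
  \<comment> \<open>The coin is independent of the arcs and may be tossed before they are
    drawn.\<close>
  also have "\<dots> = bind_pmf H (\<lambda>h. bind_pmf b (\<lambda>\<xi>. bind_pmf (R h) (\<lambda>A. arc_kernel \<beta> (Suc n) h A \<xi>)))"
    by (subst bind_commute_pmf) simp
  also have "\<dots> = bind_pmf H (\<lambda>h. bind_pmf b (\<lambda>\<xi>. bind_pmf (v h \<xi>) (\<lambda>h'. map_pmf (Pair h') (R h'))))"
  proof (intro bind_pmf_cong refl)
    fix h \<xi> assume h: "h \<in> set_pmf H"
    define V where "V = last h"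
    have len: "length h = Suc n" and V: "V \<subseteq> {1..n}" using H[OF h] by (auto simp: V_def)
    have fin: "finite V" using V finite_subset by auto
    note finA = finite_arcs_on[OF fin]
    have hn: "h ! n = V" using len by (metis V_def diff_Suc_1 last_conv_nth length_0_conv nat.distinct(1))
    \<comment> \<open>The tail of an old arc is at most \<open>n\<close>, so \<open>arc_prob\<close>
      reads a position that is not affected by appending to the history.\<close>
    have old: "arc_prob \<beta> (h @ [W]) e = arc_prob \<beta> h e" if "e \<in> arcs_on V" for W e
    proof -
      have "fst e - 1 < length h" using that V len by (fastforce simp: arcs_on_def)
      then show ?thesis by (simp add: arc_prob_def nth_append)
    qed
    have RV: "R h = random_subset (arcs_on V) (arc_prob \<beta> h)" by (simp add: R_def V_def)
    show "bind_pmf (R h) (\<lambda>A. arc_kernel \<beta> (Suc n) h A \<xi>) = bind_pmf (v h \<xi>) (\<lambda>h'. map_pmf (Pair h') (R h'))"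
    proof (cases \<xi>)
      case True
      define h' where "h' = h @ [V \<union> {Suc n}]"
      have arcs: "arcs_on (V \<union> {Suc n}) = arcs_on V \<union> Pair (Suc n) ` V"
        using V by (auto simp: arcs_on_def)
      have "R h' = map_pmf (\<lambda>(S, T). S \<union> T) (pair_pmf
          (random_subset (arcs_on V) (arc_prob \<beta> h')) (random_subset (Pair (Suc n) ` V) (arc_prob \<beta> h')))"
      proof -
        have "arcs_on V \<inter> Pair (Suc n) ` V = {}" using V by (auto simp: arcs_on_def)
        from random_subset_Un[OF finA finite_imageI[OF fin] this, of "arc_prob \<beta> h'"]
        show ?thesis unfolding R_def arcs[symmetric] by (simp add: h'_def)
      qed
      also have "random_subset (arcs_on V) (arc_prob \<beta> h') = R h"
        unfolding RV h'_def by (intro random_subset_cong refl old)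
      also have "random_subset (Pair (Suc n) ` V) (arc_prob \<beta> h')
          = map_pmf ((`) (Pair (Suc n))) (random_subset V (arc_prob \<beta> h' \<circ> Pair (Suc n)))"
        using fin assms by (intro random_subset_image) (auto simp: arc_prob_bounds inj_on_def)
      \<comment> \<open>The tail \<open>Suc n\<close> reads position \<open>n\<close> of the
        history, the last one before the arrival, which holds \<open>V\<close>.\<close>
      also have "arc_prob \<beta> h' \<circ> Pair (Suc n) = (\<lambda>_. min (\<beta> / real (card V)) 1)"
        using len hn by (auto simp: arc_prob_def h'_def nth_append)
      finally have Rh': "R h' = map_pmf (\<lambda>(S, T). S \<union> T) (pair_pmf (R h)
          (map_pmf ((`) (Pair (Suc n))) (random_subset V (\<lambda>_. min (\<beta> / real (card V)) 1))))" .
      have "bind_pmf (v h \<xi>) (\<lambda>h'. map_pmf (Pair h') (R h')) = map_pmf (Pair h') (R h')"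
        using True by (simp add: v_def h'_def V_def bind_return_pmf)
      also have "\<dots> = bind_pmf (R h) (\<lambda>A. arc_kernel \<beta> (Suc n) h A \<xi>)"
        using True unfolding Rh'
        by (simp add: arc_kernel_def pair_pmf_def map_bind_pmf bind_map_pmf pmf.map_comp o_def
            V_def h'_def map_pmf_def bind_assoc_pmf bind_return_pmf)
      finally show ?thesis by simp
    next
      case False
      show ?thesis
      proof (cases "V = {}")
        case True
        have "R (h @ [{}]) = R h" unfolding R_def using True
          by (intro random_subset_cong) (auto simp: V_def arcs_on_def)
        then show ?thesis using False True
          by (simp add: arc_kernel_def v_def V_def bind_return_pmf map_pmf_def)
      next
        case ne: False
        have "R (h @ [V - {x}]) = map_pmf (\<lambda>A. A \<inter> arcs_on (V - {x})) (R h)" for x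
        proof -
          have sub: "arcs_on (V - {x}) \<subseteq> arcs_on V" by (auto simp: arcs_on_def)
          have "R (h @ [V - {x}]) = random_subset (arcs_on (V - {x})) (arc_prob \<beta> h)"
            unfolding R_def using sub by (intro random_subset_cong) (auto intro!: old)
          then show ?thesis unfolding RV by (simp add: random_subset_Int[OF finA sub])
        qed
        then have "bind_pmf (v h \<xi>) (\<lambda>h'. map_pmf (Pair h') (R h'))
          = bind_pmf (pmf_of_set V) (\<lambda>x. bind_pmf (R h) (\<lambda>A. return_pmf (h @ [V - {x}], A \<inter> arcs_on (V - {x}))))"
          using False ne by (simp add: v_def V_def bind_map_pmf pmf.map_comp o_def map_pmf_def bind_assoc_pmf bind_return_pmf)
        also have "\<dots> = bind_pmf (R h) (\<lambda>A. arc_kernel \<beta> (Suc n) h A \<xi>)"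
          using False ne by (subst bind_commute_pmf) (simp add: arc_kernel_def V_def map_pmf_def)
        finally show ?thesis by simp
      qed
    qed
  qed
  also have "\<dots> = bind_pmf (bind_pmf H (\<lambda>h. bind_pmf b (v h))) (\<lambda>h. map_pmf (Pair h) (R h))"
    by (simp add: bind_assoc_pmf)
  finally have "map_pmf arc_state (drgvr_history \<beta> \<epsilon> (Suc n))
    = bind_pmf (bind_pmf H (\<lambda>h. bind_pmf b (v h))) (\<lambda>h. map_pmf (Pair h) (R h))" .
  moreover have "length h' = Suc (Suc n) \<and> last h' \<subseteq> {1..Suc n}"
    if mem: "h' \<in> set_pmf (bind_pmf H (\<lambda>h. bind_pmf b (v h)))" for h'
  proof -
    obtain h \<xi> where h: "h \<in> set_pmf H" and h': "h' \<in> set_pmf (v h \<xi>)" using mem by auto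
    have h1: "length h = Suc n" "last h \<subseteq> {1..n}" using H[OF h] by auto
    then have fin: "finite (last h)" using finite_subset by auto
    obtain W where "h' = h @ [W]" "W \<subseteq> last h \<union> {Suc n}"
    proof (cases \<xi>)
      case False
      show ?thesis
      proof (cases "last h = {}")
        case ne: False
        then obtain x where "h' = h @ [last h - {x}]" using h' fin False by (auto simp: v_def)
        then show ?thesis by (intro that) auto
      qed (use h' False that in \<open>auto simp: v_def\<close>)
    qed (use h' that in \<open>auto simp: v_def\<close>)
    then show ?thesis using h1 by fastforce
  qed
  ultimately show ?case unfolding R_def by blast
qed

section \<open>Conditioning on a discrete random variable\<close>

text \<open>A function measurable for the sigma-algebra of \<open>X\<close> is constant on the atom
  \<open>X = x\<close>; integrating over the atom determines the constant because its mass is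
  positive.\<close>

lemma cond_exp_given_discrete:
  assumes "prob_space M" and X[measurable]: "X \<in> measurable M (count_space UNIV)"
    and Y: "integrable M Y" and pos: "0 < measure M (X -` {x} \<inter> space M)"
    and \<omega>: "\<omega> \<in> space M" "X \<omega> = x"
  shows "cond_exp_given M X Y \<omega>
    = (\<integral>\<omega>. indicator (X -` {x} \<inter> space M) \<omega> * Y \<omega> \<partial>M) / measure M (X -` {x} \<inter> space M)"
proof -
  interpret prob_space M by fact
  define F where "F = vimage_algebra (space M) X (count_space UNIV)"
  define B where "B = X -` {x} \<inter> space M"
  have space_F: "space F = space M" by (simp add: F_def)
  have sets_F: "sets F = {X -` A \<inter> space M | A. True}"
    unfolding F_def by (subst sets_vimage_algebra2) auto
  have "sets F \<subseteq> sets M" unfolding sets_F using X by (auto simp: measurable_def)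
  then have sub: "subalgebra M F" by (simp add: subalgebra_def space_F)
  interpret S: finite_measure_subalgebra M F by unfold_locales (rule sub)
  define c where "c = real_cond_exp M F Y"
  have c[measurable]: "c \<in> borel_measurable F" unfolding c_def by (rule borel_measurable_cond_exp)
  have BF: "B \<in> sets F" unfolding sets_F B_def by auto
  then have BM: "B \<in> sets M" using \<open>sets F \<subseteq> sets M\<close> by auto
  have const: "c \<omega>' = c \<omega>" if "\<omega>' \<in> B" for \<omega>'
  proof -
    have "c -` {c \<omega>} \<inter> space F \<in> sets F" by measurable
    then obtain A where A: "c -` {c \<omega>} \<inter> space M = X -` A \<inter> space M"
      unfolding sets_F space_F by auto
    have "\<omega> \<in> X -` A \<inter> space M" unfolding A[symmetric] using \<omega> by simp
    then have "\<omega>' \<in> X -` A \<inter> space M" using that \<omega> by (auto simp: B_def)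
    then show ?thesis unfolding A[symmetric] by simp
  qed
  have "(\<integral>\<omega>\<in>B. Y \<omega> \<partial>M) = (\<integral>\<omega>\<in>B. c \<omega> \<partial>M)"
    unfolding c_def by (rule S.real_cond_exp_intA[OF Y BF])
  also have "\<dots> = (\<integral>\<omega>'\<in>B. c \<omega> \<partial>M)"
    by (intro set_lebesgue_integral_cong BM) (auto simp: const)
  also have "\<dots> = measure M B * c \<omega>"
    using BM by (simp add: set_lebesgue_integral_def)
  finally have "(\<integral>\<omega>. indicator B \<omega> * Y \<omega> \<partial>M) = measure M B * c \<omega>"
    by (simp add: set_lebesgue_integral_def)
  moreover have "cond_exp_given M X Y \<omega> = c \<omega>" by (simp add: cond_exp_given_def c_def F_def)
  ultimately show ?thesis using pos by (simp add: B_def)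
qed

text \<open>Reduces the claim on an arbitrary probability space to elementary conditioning under the
  finite law \<open>p\<close>. Almost every outcome lies over the support of \<open>p\<close>, where
  all atoms have positive mass.\<close>

lemma conditional_tail_from_pmf:
  fixes y b :: "'h \<Rightarrow> real"
  assumes M: "prob_space M" and H[measurable]: "H \<in> measurable M (count_space UNIV)"
    and law: "distr M (count_space UNIV) H = measure_pmf p" and fin: "finite (set_pmf p)"
    and tail: "\<And>h. h \<in> set_pmf p \<Longrightarrow>
      measure_pmf.prob p {h'. x h' = x h \<and> t \<le> \<bar>y h'
          - measure_pmf.expectation p (\<lambda>h'. indicator {h'. x h' = x h} h' * y h')
            / measure_pmf.prob p {h'. x h' = x h}\<bar>}
        \<le> b h * measure_pmf.prob p {h'. x h' = x h}"
  shows "AE \<omega> in M. cond_prob_given M (\<lambda>\<omega>. x (H \<omega>))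
      {\<omega>' \<in> space M. t \<le> \<bar>y (H \<omega>') - cond_exp_given M (\<lambda>\<omega>. x (H \<omega>)) (\<lambda>\<omega>. y (H \<omega>)) \<omega>'\<bar>} \<omega>
    \<le> b (H \<omega>)"
proof -
  interpret prob_space M by fact
  define X where "X = (\<lambda>\<omega>. x (H \<omega>))"
  define Y where "Y = (\<lambda>\<omega>. y (H \<omega>))"
  have X: "X \<in> measurable M (count_space UNIV)"
    unfolding X_def by (rule measurable_compose[OF H measurable_count_space])
  have meas: "measure M (H -` A \<inter> space M) = measure_pmf.prob p A" for A
    unfolding law[symmetric] by (subst measure_distr) auto
  have expct: "(\<integral>\<omega>. g (H \<omega>) \<partial>M) = measure_pmf.expectation p g" for g :: "'h \<Rightarrow> real"
    unfolding law[symmetric] by (subst integral_distr) auto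
  have "integrable (distr M (count_space UNIV) H) y"
    unfolding law by (rule integrable_measure_pmf_finite[OF fin])
  then have Y: "integrable M Y" unfolding Y_def by (subst (asm) integrable_distr_eq) auto
  define C where "C = cond_exp_given M X Y"
  define A where "A = {\<omega>' \<in> space M. t \<le> \<bar>Y \<omega>' - C \<omega>'\<bar>}"
  have [measurable]: "C \<in> borel_measurable M" "Y \<in> borel_measurable M"
    using Y by (auto simp: C_def cond_exp_given_def intro: borel_measurable_cond_exp2)
  have A[measurable]: "A \<in> sets M" unfolding A_def by measurable
  have supp: "AE \<omega> in M. H \<omega> \<in> set_pmf p"
  proof -
    have "AE h in distr M (count_space UNIV) H. h \<in> set_pmf p"
      unfolding law by (simp add: AE_measure_pmf_iff)
    then show ?thesis by (subst (asm) AE_distr_iff) auto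
  qed
  have "cond_prob_given M X A \<omega> \<le> b (H \<omega>)" if \<omega>: "\<omega> \<in> space M" "H \<omega> \<in> set_pmf p" for \<omega>
  proof -
    define D where "D = {h'. x h' = x (H \<omega>)}"
    have XD: "X -` {X \<omega>} \<inter> space M = H -` D \<inter> space M" by (auto simp: X_def D_def)
    have "0 < pmf p (H \<omega>)" using \<omega> by (simp add: pmf_positive)
    also have "\<dots> \<le> measure_pmf.prob p D"
      unfolding measure_pmf_single[symmetric] by (intro measure_pmf.finite_measure_mono) (auto simp: D_def)
    finally have pos: "0 < measure_pmf.prob p D" .
    then have pos': "0 < measure M (X -` {X \<omega>} \<inter> space M)" by (simp add: XD meas)
    define \<mu> where "\<mu> = measure_pmf.expectation p (\<lambda>h'. indicator D h' * y h') / measure_pmf.prob p D"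
    have C: "C \<omega>' = \<mu>" if "\<omega>' \<in> space M" "X \<omega>' = X \<omega>" for \<omega>'
    proof -
      have "(\<integral>z. indicator (X -` {X \<omega>} \<inter> space M) z * Y z \<partial>M) = (\<integral>z. indicator D (H z) * y (H z) \<partial>M)"
        unfolding XD by (intro Bochner_Integration.integral_cong) (auto simp: Y_def indicator_def)
      then show ?thesis
        unfolding C_def cond_exp_given_discrete[OF M X Y pos' that] \<mu>_def XD meas
        using expct[of "\<lambda>h. indicator D h * y h"] by simp
    qed
    \<comment> \<open>On the atom, the conditional expectation inside the event is the number
      \<open>\<mu>\<close>, so the event depends on the history alone.\<close>
    have AB: "(X -` {X \<omega>} \<inter> space M) \<inter> A = H -` {h'. x h' = x (H \<omega>) \<and> t \<le> \<bar>y h' - \<mu>\<bar>} \<inter> space M"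
      using C by (auto simp: A_def X_def Y_def)
    have "cond_prob_given M X A \<omega>
      = (\<integral>\<omega>'. indicator (X -` {X \<omega>} \<inter> space M) \<omega>' * indicator A \<omega>' \<partial>M) / measure M (X -` {X \<omega>} \<inter> space M)"
      unfolding cond_prob_given_def using A
      by (intro cond_exp_given_discrete[OF M X _ pos' \<omega>(1) refl]) (simp add: integrable_indicator_iff emeasure_eq_measure)
    also have "(\<integral>\<omega>'. indicator (X -` {X \<omega>} \<inter> space M) \<omega>' * indicator A \<omega>' \<partial>M)
      = measure M ((X -` {X \<omega>} \<inter> space M) \<inter> A)"
    proof -
      have "(\<lambda>\<omega>'. indicator (X -` {X \<omega>} \<inter> space M) \<omega>' * indicator A \<omega>')
        = (indicator ((X -` {X \<omega>} \<inter> space M) \<inter> A) :: _ \<Rightarrow> real)"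
        by (auto simp: indicator_def fun_eq_iff)
      moreover have "(X -` {X \<omega>} \<inter> space M) \<inter> A \<inter> space M = (X -` {X \<omega>} \<inter> space M) \<inter> A" by auto
      ultimately show ?thesis by (simp only: Bochner_Integration.integral_indicator)
    qed
    also have "\<dots> = measure_pmf.prob p {h'. x h' = x (H \<omega>) \<and> t \<le> \<bar>y h' - \<mu>\<bar>}"
      unfolding AB meas ..
    also have "\<dots> / measure M (X -` {X \<omega>} \<inter> space M) \<le> b (H \<omega>)"
      using tail[OF \<omega>(2)] pos unfolding XD meas \<mu>_def D_def by (simp add: field_simps)
    finally show ?thesis .
  qed
  then show ?thesis using supp unfolding X_def Y_def A_def C_def by (auto elim: AE_mp)
qed

section \<open>Conditioning on the vertex history and the number of edges\<close>

text \<open>On the conditioning event, \<open>z\<close> has masses \<open>K * W S\<close>. The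
  factor \<open>K\<close> absorbs whatever is irrelevant for the conditional law and cancels from
  the mean.\<close>

lemma tail_from_weights:
  assumes fin: "finite \<B>" and W: "\<And>S. S \<in> \<B> \<Longrightarrow> 0 \<le> W S" and "0 \<le> K"
    and mass: "\<And>\<psi>. measure_pmf.expectation p (\<lambda>h'. indicator {h'. x h' = x h} h' * \<psi> (z h'))
      = K * (\<Sum>S\<in>\<B>. W S * \<psi> S)"
    and y: "\<And>h'. h' \<in> set_pmf p \<Longrightarrow> x h' = x h \<Longrightarrow> y h' = g (z h')"
    and conc: "swap_concentrated c v \<B> W" and lip: "swap_lipschitz c \<B> g"
    and "0 \<le> v" and "0 \<le> t"
  shows "measure_pmf.prob p {h'. x h' = x h \<and> t \<le> \<bar>y h'
          - measure_pmf.expectation p (\<lambda>h'. indicator {h'. x h' = x h} h' * y h')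
            / measure_pmf.prob p {h'. x h' = x h}\<bar>}
        \<le> gauss_tail t (4 * v) * measure_pmf.prob p {h'. x h' = x h}"
proof -
  define D where "D = {h'. x h' = x h}"
  define \<mu> where "\<mu> = measure_pmf.expectation p (\<lambda>h'. indicator D h' * y h') / measure_pmf.prob p D"
  define \<psi> where "\<psi> S = (if t \<le> \<bar>g S - \<mu>\<bar> then 1 else 0 :: real)" for S
  have "measure_pmf.prob p D = measure_pmf.expectation p (\<lambda>h'. indicator D h' * 1)" by simp
  also have "\<dots> = K * (\<Sum>S\<in>\<B>. W S * 1)" unfolding D_def by (rule mass)
  finally have PD: "measure_pmf.prob p D = K * (\<Sum>S\<in>\<B>. W S)" by simp
  have "measure_pmf.expectation p (\<lambda>h'. indicator D h' * y h')
      = measure_pmf.expectation p (\<lambda>h'. indicator D h' * g (z h'))"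
    by (intro integral_cong_AE) (auto simp: AE_measure_pmf_iff D_def y indicator_def)
  also have "\<dots> = K * (\<Sum>S\<in>\<B>. W S * g S)" unfolding D_def by (rule mass)
  finally have ED: "measure_pmf.expectation p (\<lambda>h'. indicator D h' * y h') = K * (\<Sum>S\<in>\<B>. W S * g S)" .
  have "measure_pmf.prob p {h'. x h' = x h \<and> t \<le> \<bar>y h' - \<mu>\<bar>}
    = measure_pmf.expectation p (indicator {h'. x h' = x h \<and> t \<le> \<bar>y h' - \<mu>\<bar>})" by simp
  also have "\<dots> = measure_pmf.expectation p (\<lambda>h'. indicator D h' * \<psi> (z h'))"
    by (intro integral_cong_AE) (auto simp: AE_measure_pmf_iff D_def y indicator_def \<psi>_def)
  also have "\<dots> = K * (\<Sum>S\<in>\<B>. W S * \<psi> S)" unfolding D_def by (rule mass)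
  also have "(\<Sum>S\<in>\<B>. W S * \<psi> S) = (\<Sum>S | S \<in> \<B> \<and> t \<le> \<bar>g S - \<mu>\<bar>. W S)"
    unfolding \<psi>_def using fin by (intro sum.mono_neutral_cong_right) auto
  also have "K * \<dots> \<le> K * (gauss_tail t (4 * v) * (\<Sum>S\<in>\<B>. W S))"
  \<comment> \<open>For \<open>K = 0\<close> both sides vanish; there \<open>\<mu>\<close> is
    \<open>0 / 0\<close> and need not be the weighted mean.\<close>
  proof (cases "K = 0")
    case False
    then have "\<mu> = (\<Sum>S\<in>\<B>. W S * g S) / (\<Sum>S\<in>\<B>. W S)" by (simp add: \<mu>_def PD ED)
    then show ?thesis
      using swap_concentrated_tail[OF fin W conc lip \<open>0 \<le> v\<close> \<open>0 \<le> t\<close>] \<open>0 \<le> K\<close>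
      by (intro mult_left_mono) auto
  qed simp
  finally have "measure_pmf.prob p {h'. x h' = x h \<and> t \<le> \<bar>y h' - \<mu>\<bar>}
      \<le> gauss_tail t (4 * v) * measure_pmf.prob p D"
    by (simp add: PD mult.left_commute)
  then show ?thesis unfolding \<mu>_def D_def .
qed

text \<open>Pass from \<open>S\<close> to \<open>T\<close> through \<open>S \<inter> T\<close>: each
  half changes at most one arc. The detour leaves the layer, so the bound is proved on the full
  power set and restricted afterwards.\<close>

lemma swap_lipschitz_digraph:
  assumes f: "digraph_lipschitz L f" and V: "finite V"
  shows "swap_lipschitz (2 * L) (Pow (arcs_on V)) (\<lambda>S. f \<lparr>pverts = V, parcs = S\<rparr>)"
proof -
  have dg: "pair_digraph \<lparr>pverts = V, parcs = S\<rparr>" if "S \<subseteq> arcs_on V" for S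
  proof
    show "finite (parcs \<lparr>pverts = V, parcs = S\<rparr>)"
      using that finite_arcs_on[OF V] finite_subset by auto
  qed (use that V in \<open>auto simp: arcs_on_def\<close>)
  have step: "\<bar>f \<lparr>pverts = V, parcs = S\<rparr> - f \<lparr>pverts = V, parcs = S \<inter> T\<rparr>\<bar> \<le> L"
    if "S \<subseteq> arcs_on V" "card (S - T) \<le> 1" for S T
  proof -
    have eq: "S - S \<inter> T = S - T" "S \<inter> T - S = {}" and sub: "S \<inter> T \<subseteq> arcs_on V"
      using that by auto
    have "card (S - S \<inter> T) + card (S \<inter> T - S) \<le> 1" unfolding eq using that by simp
    then show ?thesis
      by (intro f[unfolded digraph_lipschitz_def, rule_format, OF dg[OF that(1)] dg[OF sub]]) simp
  qed
  show ?thesis unfolding swap_lipschitz_def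
  proof (intro ballI impI)
    fix S T assume "S \<in> Pow (arcs_on V)" "T \<in> Pow (arcs_on V)" "card (S - T) \<le> 1" "card (T - S) \<le> 1"
    then show "\<bar>f \<lparr>pverts = V, parcs = S\<rparr> - f \<lparr>pverts = V, parcs = T\<rparr>\<bar> \<le> 2 * L"
      using step[of S T] step[of T S] by (simp add: Int_commute)
  qed
qed

lemma swap_lipschitz_subset: "swap_lipschitz c \<B> g \<Longrightarrow> \<A> \<subseteq> \<B> \<Longrightarrow> swap_lipschitz c \<A> g"
  unfolding swap_lipschitz_def by blast

text \<open>The left denominator is \<open>2 * m * L\<^sup>2\<close>; the factor of four up to the
  stated constant is given away here.\<close>

lemma gauss_tail_swap:
  "gauss_tail t (4 * (real m * (2 * L)\<^sup>2 / 8)) \<le> gauss_tail t (8 * real m * L\<^sup>2)"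
proof -
  have "4 * (real m * (2 * L)\<^sup>2 / 8) = 2 * (real m * L\<^sup>2)"
    by (simp add: power2_eq_square)
  then show ?thesis using gauss_tail_mono4[of "2 * (real m * L\<^sup>2)" t] by (simp add: mult.assoc)
qed

text \<open>On a fixed history the arcs follow a product law, so fixing their number yields the
  weights of a layer, scaled by the probability of the history.\<close>

lemma arc_state_mass:
  assumes "0 < \<beta>"
    and H: "\<forall>h\<in>set_pmf H. length h = Suc n \<and> last h \<subseteq> {1..n}"
    and law: "map_pmf arc_state (drgvr_history \<beta> \<epsilon> n)
      = bind_pmf H (\<lambda>h. map_pmf (Pair h) (random_subset (arcs_on (last h)) (arc_prob \<beta> h)))"
    and fin: "finite (last h\<^sub>0)"
  shows "measure_pmf.expectation (drgvr_history \<beta> \<epsilon> n)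
      (\<lambda>gs. indicator {gs. map vertices gs = h\<^sub>0 \<and> card (parcs (orient (last gs))) = m} gs
         * \<psi> (parcs (orient (last gs))))
    = pmf H h\<^sub>0 * (\<Sum>S\<in>layer (arcs_on (last h\<^sub>0)) (int m).
         wt (arc_prob \<beta> h\<^sub>0) (\<lambda>e. 1 - arc_prob \<beta> h\<^sub>0 e) (arcs_on (last h\<^sub>0)) S * \<psi> S)"
proof -
  define R where "R h = random_subset (arcs_on (last h)) (arc_prob \<beta> h)" for h
  define P where "P = bind_pmf H (\<lambda>h. map_pmf (Pair h) (R h))"
  note finA = finite_arcs_on[OF fin]
  have pmf_P: "pmf P (h\<^sub>0, S) = pmf H h\<^sub>0 * pmf (R h\<^sub>0) S" for S
  proof -
    have "pmf (map_pmf (Pair h) (R h)) (h\<^sub>0, S) = pmf (R h\<^sub>0) S * indicator {h\<^sub>0} h" for h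
    proof (cases "h = h\<^sub>0")
      case True
      then show ?thesis by (simp add: pmf_map_inj' inj_on_def)
    next
      case False
      then have "(h\<^sub>0, S) \<notin> set_pmf (map_pmf (Pair h) (R h))" by auto
      then have "pmf (map_pmf (Pair h) (R h)) (h\<^sub>0, S) = 0" by (meson set_pmf_iff)
      then show ?thesis using False by simp
    qed
    then show ?thesis unfolding P_def pmf_bind by (simp add: measure_pmf_single)
  qed
  have supp: "S \<subseteq> arcs_on (last h\<^sub>0)" if "(h\<^sub>0, S) \<in> set_pmf P" for S
    using that set_random_subset[OF finA] by (auto simp: P_def R_def)
  define \<phi> where "\<phi> = (\<lambda>(h, S). if h = h\<^sub>0 \<and> card S = m then \<psi> S else 0)"
  have "measure_pmf.expectation (drgvr_history \<beta> \<epsilon> n)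
      (\<lambda>gs. indicator {gs. map vertices gs = h\<^sub>0 \<and> card (parcs (orient (last gs))) = m} gs
         * \<psi> (parcs (orient (last gs))))
    = measure_pmf.expectation (drgvr_history \<beta> \<epsilon> n) (\<lambda>gs. \<phi> (arc_state gs))"
    by (intro Bochner_Integration.integral_cong) (auto simp: \<phi>_def arc_state_def indicator_def)
  also have "\<dots> = measure_pmf.expectation P \<phi>"
    unfolding P_def R_def law[symmetric] by simp
  also have "\<dots> = (\<Sum>a\<in>Pair h\<^sub>0 ` layer (arcs_on (last h\<^sub>0)) (int m). \<phi> a * pmf P a)"
  proof (rule integral_measure_pmf_real)
    fix a assume "a \<in> set_pmf P" "\<phi> a \<noteq> 0"
    then show "a \<in> Pair h\<^sub>0 ` layer (arcs_on (last h\<^sub>0)) (int m)"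
      using supp by (cases a) (auto simp: \<phi>_def layer_def split: if_splits)
  qed (simp add: finite_layer finA)
  also have "\<dots> = (\<Sum>S\<in>layer (arcs_on (last h\<^sub>0)) (int m). \<psi> S * (pmf H h\<^sub>0 * pmf (R h\<^sub>0) S))"
    by (subst sum.reindex) (auto simp: inj_on_def \<phi>_def pmf_P layer_def intro!: sum.cong)
  also have "\<dots> = pmf H h\<^sub>0 * (\<Sum>S\<in>layer (arcs_on (last h\<^sub>0)) (int m).
         wt (arc_prob \<beta> h\<^sub>0) (\<lambda>e. 1 - arc_prob \<beta> h\<^sub>0 e) (arcs_on (last h\<^sub>0)) S * \<psi> S)"
    unfolding sum_distrib_left R_def using assms(1) finA
    by (intro sum.cong refl) (simp add: pmf_random_subset arc_prob_bounds layer_def)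
  finally show ?thesis .
qed

lemma tail_given_vertex_history:
  assumes \<beta>: "0 < \<beta>" and f: "digraph_lipschitz L f" and "0 \<le> L" and t: "0 \<le> t"
    and gs: "gs \<in> set_pmf (drgvr_history \<beta> \<epsilon> n)"
  defines "x \<equiv> \<lambda>gs :: ugraph list. (map vertices (tl gs), card (edges (last gs)))"
    and "y \<equiv> \<lambda>gs. f (orient (last gs))"
  shows "measure_pmf.prob (drgvr_history \<beta> \<epsilon> n) {gs'. x gs' = x gs \<and> t \<le> \<bar>y gs'
          - measure_pmf.expectation (drgvr_history \<beta> \<epsilon> n) (\<lambda>gs'. indicator {gs'. x gs' = x gs} gs' * y gs')
            / measure_pmf.prob (drgvr_history \<beta> \<epsilon> n) {gs'. x gs' = x gs}\<bar>}
        \<le> gauss_tail t (8 * real (card (edges (last gs))) * L\<^sup>2)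
          * measure_pmf.prob (drgvr_history \<beta> \<epsilon> n) {gs'. x gs' = x gs}"
proof -
  let ?p = "drgvr_history \<beta> \<epsilon> n"
  obtain H where H: "\<forall>h\<in>set_pmf H. length h = Suc n \<and> last h \<subseteq> {1..n}"
    and law: "map_pmf arc_state ?p
      = bind_pmf H (\<lambda>h. map_pmf (Pair h) (random_subset (arcs_on (last h)) (arc_prob \<beta> h)))"
    using arc_state_law[OF \<beta>] by blast
  define h\<^sub>0 where "h\<^sub>0 = map vertices gs"
  define m where "m = card (edges (last gs))"
  define V where "V = last h\<^sub>0"
  have ne: "gs \<noteq> []" and val: "valid_graph n (last gs)" using drgvr_history_last_valid[OF gs] by auto
  have V: "V = vertices (last gs)" using ne by (simp add: V_def h\<^sub>0_def last_map)
  have finV: "finite V" using val finite_subset[of V "{1..n}"] by (simp add: V valid_graph_def)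
  have x_iff: "x gs' = x gs \<longleftrightarrow> map vertices gs' = h\<^sub>0 \<and> card (parcs (orient (last gs'))) = m"
    if gs': "gs' \<in> set_pmf ?p" for gs'
  proof -
    \<comment> \<open>The conditioning variable starts at time 1, but the vertex set at time 0 is
      always empty, so it fixes the complete history.\<close>
    have "map vertices k = {} # map vertices (tl k)" if "k \<in> set_pmf ?p" for k
      using drgvr_history_valid[OF that] by (cases k) auto
    from this[OF gs] this[OF gs'] show ?thesis
      unfolding card_parcs_orient[OF drgvr_history_last_valid(2)[OF gs']] x_def h\<^sub>0_def m_def
      by (metis list.inject prod.inject)
  qed
  let ?w = "wt (arc_prob \<beta> h\<^sub>0) (\<lambda>e. 1 - arc_prob \<beta> h\<^sub>0 e) (arcs_on V)"
  have wnn: "0 \<le> ?w S" if "S \<in> layer (arcs_on V) (int m)" for S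
    using that \<beta> by (intro wt_nonneg) (auto simp: arc_prob_bounds layer_def)
  have "measure_pmf.prob ?p {gs'. x gs' = x gs \<and> t \<le> \<bar>y gs'
          - measure_pmf.expectation ?p (\<lambda>gs'. indicator {gs'. x gs' = x gs} gs' * y gs')
            / measure_pmf.prob ?p {gs'. x gs' = x gs}\<bar>}
        \<le> gauss_tail t (4 * (real m * (2 * L)\<^sup>2 / 8)) * measure_pmf.prob ?p {gs'. x gs' = x gs}"
  proof (rule tail_from_weights[where \<B> = "layer (arcs_on V) (int m)" and W = ?w and K = "pmf H h\<^sub>0"
        and z = "\<lambda>gs. parcs (orient (last gs))" and g = "\<lambda>S. f \<lparr>pverts = V, parcs = S\<rparr>" and c = "2 * L"])
    show "finite (layer (arcs_on V) (int m))" by (simp add: finite_layer finite_arcs_on finV)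
    show "measure_pmf.expectation ?p (\<lambda>gs'. indicator {gs'. x gs' = x gs} gs' * \<psi> (parcs (orient (last gs'))))
      = pmf H h\<^sub>0 * (\<Sum>S\<in>layer (arcs_on V) (int m). ?w S * \<psi> S)" for \<psi>
    proof -
      have "measure_pmf.expectation ?p (\<lambda>gs'. indicator {gs'. x gs' = x gs} gs' * \<psi> (parcs (orient (last gs'))))
        = measure_pmf.expectation ?p (\<lambda>gs. indicator {gs. map vertices gs = h\<^sub>0 \<and> card (parcs (orient (last gs))) = m} gs
         * \<psi> (parcs (orient (last gs))))"
        by (intro integral_cong_AE) (auto simp: AE_measure_pmf_iff x_iff indicator_def)
      then show ?thesis using arc_state_mass[OF \<beta> H law, of h\<^sub>0] finV by (simp add: V_def)
    qed
    show "y gs' = f \<lparr>pverts = V, parcs = parcs (orient (last gs'))\<rparr>"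
      if "gs' \<in> set_pmf ?p" "x gs' = x gs" for gs'
    proof -
      have "vertices (last gs') = last (map vertices gs')"
        using drgvr_history_last_valid(1)[OF that(1)] by (simp add: last_map)
      then have "vertices (last gs') = V" using x_iff that by (simp add: V_def)
      then show ?thesis by (simp add: y_def orient_def)
    qed
    show "swap_concentrated (2 * L) (real m * (2 * L)\<^sup>2 / 8) (layer (arcs_on V) (int m)) ?w"
      using \<beta> \<open>0 \<le> L\<close>
      by (intro swap_concentrated_layer) (auto simp: finite_arcs_on finV arc_prob_bounds)
    show "swap_lipschitz (2 * L) (layer (arcs_on V) (int m)) (\<lambda>S. f \<lparr>pverts = V, parcs = S\<rparr>)"
      by (rule swap_lipschitz_subset[OF swap_lipschitz_digraph[OF f finV]]) (auto simp: layer_def)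
  qed (use wnn t in auto)
  also have "\<dots> \<le> gauss_tail t (8 * real m * L\<^sup>2) * measure_pmf.prob ?p {gs'. x gs' = x gs}"
    by (intro mult_right_mono gauss_tail_swap) simp
  finally show ?thesis by (simp add: m_def)
qed

section \<open>Conditioning on the out-degrees\<close>

definition out_deg :: "('a \<times> 'b) set \<Rightarrow> 'a \<Rightarrow> nat" where
  "out_deg S j = card {e \<in> S. fst e = j}"

definition degree_class :: "nat \<Rightarrow> (nat \<Rightarrow> nat) \<Rightarrow> (nat \<times> nat) set set" where
  "degree_class N d = {S. S \<subseteq> arcs_on {1..N} \<and> (\<forall>j\<in>{1..N}. out_deg S j = d j)}"

lemma finite_degree_class: "finite (degree_class N d)"
  unfolding degree_class_def
  by (rule finite_subset[of _ "Pow (arcs_on {1..N})"]) (auto simp: finite_arcs_on)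

text \<open>The arcs with tail \<open>Suc N\<close> can be any \<open>d (Suc N)\<close> of the
  \<open>N\<close> possible ones, independently of the other arcs: the product shape required for
  tensorisation.\<close>

lemma degree_class_Suc:
  "degree_class (Suc N) d
    = (\<lambda>(S, T). S \<union> T) ` (degree_class N d \<times> layer ({Suc N} \<times> {1..N}) (int (d (Suc N))))"
proof (intro equalityI subsetI)
  fix X assume X: "X \<in> degree_class (Suc N) d"
  define S where "S = {e \<in> X. fst e \<noteq> Suc N}"
  define T where "T = {e \<in> X. fst e = Suc N}"
  have "out_deg S j = d j" if "j \<in> {1..N}" for j
  proof -
    have "{e \<in> S. fst e = j} = {e \<in> X. fst e = j}" using that by (auto simp: S_def)
    then show ?thesis using X that by (simp add: out_deg_def degree_class_def)
  qed
  moreover have "S \<subseteq> arcs_on {1..N}"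
    using X by (fastforce simp: S_def degree_class_def arcs_on_def)
  moreover have "T \<subseteq> {Suc N} \<times> {1..N}"
    using X by (fastforce simp: T_def degree_class_def arcs_on_def)
  moreover have "card T = d (Suc N)"
    using X by (simp add: T_def degree_class_def out_deg_def)
  ultimately have "(S, T) \<in> degree_class N d \<times> layer ({Suc N} \<times> {1..N}) (int (d (Suc N)))"
    by (simp add: degree_class_def layer_def)
  moreover have "X = S \<union> T" by (auto simp: S_def T_def)
  ultimately show "X \<in> (\<lambda>(S, T). S \<union> T) ` (degree_class N d \<times> layer ({Suc N} \<times> {1..N}) (int (d (Suc N))))"
    by (metis (no_types, lifting) case_prod_conv image_eqI)
next
  fix X assume "X \<in> (\<lambda>(S, T). S \<union> T) ` (degree_class N d \<times> layer ({Suc N} \<times> {1..N}) (int (d (Suc N))))"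
  then obtain S T where X: "X = S \<union> T" and S: "S \<in> degree_class N d"
    and T: "T \<subseteq> {Suc N} \<times> {1..N}" "card T = d (Suc N)"
    by (auto simp: layer_def)
  have Ssub: "S \<subseteq> arcs_on {1..N}" using S by (simp add: degree_class_def)
  have "out_deg X j = d j" if "j \<in> {1..Suc N}" for j
  proof (cases "j = Suc N")
    case True
    have "{e \<in> X. fst e = j} = T" using True T Ssub by (auto simp: X arcs_on_def)
    then show ?thesis using True T by (simp add: out_deg_def)
  next
    case False
    have "{e \<in> X. fst e = j} = {e \<in> S. fst e = j}" using False T by (auto simp: X)
    then show ?thesis using False that S by (simp add: out_deg_def degree_class_def)
  qed
  moreover have "X \<subseteq> arcs_on {1..Suc N}"
    using Ssub T by (fastforce simp: X arcs_on_def)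
  ultimately show "X \<in> degree_class (Suc N) d" by (simp add: degree_class_def)
qed

lemma wt_one: "wt (\<lambda>_. 1) (\<lambda>_. 1) E = (\<lambda>_. 1)"
  by (simp add: wt_def fun_eq_iff)

text \<open>Each vertex contributes a uniform layer, and the exponents add up to the total
  out-degree, the number of arcs.\<close>

lemma swap_concentrated_degree_class:
  assumes "0 \<le> c"
  shows "swap_concentrated c (real (\<Sum>j=1..N. d j) * c\<^sup>2 / 8) (degree_class N d) (\<lambda>_. 1)"
proof (induction N)
  case 0
  have "degree_class 0 d = {{}}" by (auto simp: degree_class_def arcs_on_def)
  then show ?case by (simp add: swap_concentrated_def)
next
  case (Suc N)
  have "swap_concentrated c (real (\<Sum>j=1..N. d j) * c\<^sup>2 / 8 + real (d (Suc N)) * c\<^sup>2 / 8)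
    (degree_class (Suc N) d) (\<lambda>_. 1)"
    unfolding degree_class_Suc
  proof (rule swap_concentrated_product[OF _ _ _ _ _ Suc.IH])
    show "finite (arcs_on {1..N})" by (simp add: finite_arcs_on)
    show "arcs_on {1..N} \<inter> {Suc N} \<times> {1..N} = {}" by (auto simp: arcs_on_def)
    show "degree_class N d \<subseteq> Pow (arcs_on {1..N})" by (auto simp: degree_class_def)
    show "layer ({Suc N} \<times> {1..N}) (int (d (Suc N))) \<subseteq> Pow ({Suc N} \<times> {1..N})"
      by (auto simp: layer_def)
    show "swap_concentrated c (real (d (Suc N)) * c\<^sup>2 / 8)
        (layer ({Suc N} \<times> {1..N}) (int (d (Suc N)))) (\<lambda>_. 1)"
      using swap_concentrated_layer[of "{Suc N} \<times> {1..N}" "\<lambda>_. 1" "\<lambda>_. 1" c "d (Suc N)"] assms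
      by (simp add: wt_one)
  qed simp
  then show ?case by (simp add: algebra_simps add_divide_distrib)
qed

lemma sum_out_deg:
  assumes "S \<subseteq> arcs_on {1..N}"
  shows "(\<Sum>j=1..N. out_deg S j) = card S"
proof -
  have "finite S" using assms finite_arcs_on[of "{1..N}"] finite_subset by blast
  moreover have "fst ` S \<subseteq> {1..N}" using assms by (auto simp: arcs_on_def)
  ultimately have "(\<Sum>j=1..N. \<Sum>e | e \<in> S \<and> fst e = j. 1 :: nat) = (\<Sum>e\<in>S. 1)"
    by (intro sum.group) auto
  then show ?thesis by (simp add: out_deg_def)
qed

lemma prod_fst:
  fixes a :: "nat \<Rightarrow> real"
  assumes "finite S" "fst ` S \<subseteq> {1..N}"
  shows "(\<Prod>e\<in>S. a (fst e)) = (\<Prod>j=1..N. a j ^ out_deg S j)"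
proof -
  have "(\<Prod>j=1..N. \<Prod>e | e \<in> S \<and> fst e = j. a (fst e)) = (\<Prod>e\<in>S. a (fst e))"
    using assms by (intro prod.group) auto
  moreover have "(\<Prod>e | e \<in> S \<and> fst e = j. a (fst e)) = a j ^ out_deg S j" for j
    by (simp add: out_deg_def)
  ultimately show ?thesis by simp
qed

text \<open>With factors depending on the tail only, grouping the product by tails leaves
  \<open>a j ^ d j\<close> and a power of \<open>b j\<close> given by the number of absent arcs at
  \<open>j\<close>; neither sees the heads.\<close>

lemma wt_fst_cong:
  fixes a b :: "nat \<Rightarrow> real"
  assumes "S \<in> degree_class N d" "T \<in> degree_class N d"
  shows "wt (\<lambda>e. a (fst e)) (\<lambda>e. b (fst e)) (arcs_on {1..N}) S
    = wt (\<lambda>e. a (fst e)) (\<lambda>e. b (fst e)) (arcs_on {1..N}) T"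
proof -
  have *: "wt (\<lambda>e. a (fst e)) (\<lambda>e. b (fst e)) (arcs_on {1..N}) S
    = (\<Prod>j=1..N. a j ^ d j) * (\<Prod>j=1..N. b j ^ (out_deg (arcs_on {1..N}) j - d j))"
    if S: "S \<in> degree_class N d" for S
  proof -
    have sub: "S \<subseteq> arcs_on {1..N}" and deg: "\<And>j. j \<in> {1..N} \<Longrightarrow> out_deg S j = d j"
      using S by (auto simp: degree_class_def)
    have fin: "finite S" "finite (arcs_on {1..N})"
      using finite_arcs_on[of "{1..N}"] finite_subset[OF sub] by auto
    have fst: "fst ` S \<subseteq> {1..N}" "fst ` (arcs_on {1..N} - S) \<subseteq> {1..N}"
      using sub by (auto simp: arcs_on_def)
    have "out_deg (arcs_on {1..N} - S) j = out_deg (arcs_on {1..N}) j - d j" if "j \<in> {1..N}" for j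
    proof -
      have "{e \<in> arcs_on {1..N} - S. fst e = j} = {e \<in> arcs_on {1..N}. fst e = j} - {e \<in> S. fst e = j}"
        by auto
      moreover have "{e \<in> S. fst e = j} \<subseteq> {e \<in> arcs_on {1..N}. fst e = j}" using sub by auto
      ultimately show ?thesis
        using fin deg[OF that] by (simp add: out_deg_def card_Diff_subset)
    qed
    then show ?thesis
      unfolding wt_def using prod_fst[OF fin(1) fst(1), of a] deg
        prod_fst[OF finite_Diff[OF fin(2)] fst(2), of b] by simp
  qed
  show ?thesis unfolding *[OF assms(1)] *[OF assms(2)] ..
qed

section \<open>Order-preserving relabelling of the vertices\<close>

lemma nth_vertex_bij: "finite V \<Longrightarrow> bij_betw (nth_vertex V) {1..card V} V"
proof -
  assume V: "finite V"
  have "bij_betw ((!) (sorted_list_of_set V)) {..<card V} V"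
    using V by (intro bij_betw_nth) auto
  moreover have "bij_betw (\<lambda>i. i - 1) {1..card V} {..<card V}"
    by (rule bij_betw_byWitness[where f' = Suc]) auto
  ultimately have "bij_betw ((!) (sorted_list_of_set V) \<circ> (\<lambda>i. i - 1)) {1..card V} V"
    by (rule bij_betw_trans[rotated])
  then show ?thesis by (simp add: nth_vertex_def[abs_def] o_def)
qed

text \<open>Birth order survives the relabelling, so arcs still point from the larger to the smaller
  label.\<close>

lemma nth_vertex_less_iff:
  assumes "finite V" "i \<in> {1..card V}" "j \<in> {1..card V}"
  shows "nth_vertex V i < nth_vertex V j \<longleftrightarrow> i < j"
proof -
  have less: "nth_vertex V i < nth_vertex V j"
    if "i \<in> {1..card V}" "j \<in> {1..card V}" "i < j" for i j
  proof -
    have "i - 1 < j - 1" "j - 1 < length (sorted_list_of_set V)" using that by auto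
    then show ?thesis unfolding nth_vertex_def
      using strict_sorted_list_of_set by (rule sorted_wrt_nth_less[rotated 1])
  qed
  show ?thesis using less[of i j] less[of j i] assms by (cases i j rule: linorder_cases) auto
qed

definition relabel :: "nat set \<Rightarrow> (nat \<times> nat) set \<Rightarrow> (nat \<times> nat) set" where
  "relabel V A = {(j, i). j \<in> {1..card V} \<and> i \<in> {1..card V} \<and> (nth_vertex V j, nth_vertex V i) \<in> A}"

abbreviation lift_arcs :: "nat set \<Rightarrow> nat \<times> nat \<Rightarrow> nat \<times> nat" where
  "lift_arcs V \<equiv> map_prod (nth_vertex V) (nth_vertex V)"

lemma orient_relabelled_eq:
  "orient_relabelled g
    = \<lparr>pverts = {1..card (vertices g)}, parcs = relabel (vertices g) (parcs (orient g))\<rparr>"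
  by (simp add: orient_relabelled_def relabel_def Let_def)

lemma inj_lift_arcs:
  assumes "finite V" shows "inj_on (lift_arcs V) (arcs_on {1..card V})"
proof -
  have "inj_on (lift_arcs V) ({1..card V} \<times> {1..card V})"
    using nth_vertex_bij[OF assms] by (intro map_prod_inj_on) (auto simp: bij_betw_def)
  then show ?thesis by (rule inj_on_subset) (auto simp: arcs_on_def)
qed

lemma relabel_subset:
  assumes "finite V" "A \<subseteq> arcs_on V" shows "relabel V A \<subseteq> arcs_on {1..card V}"
proof clarify
  fix j i assume "(j, i) \<in> relabel V A"
  then have m: "j \<in> {1..card V}" "i \<in> {1..card V}" and "(nth_vertex V j, nth_vertex V i) \<in> A"
    by (simp_all add: relabel_def)
  then have "nth_vertex V i < nth_vertex V j" using assms by (auto simp: arcs_on_def)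
  then show "(j, i) \<in> arcs_on {1..card V}"
    using nth_vertex_less_iff[OF assms(1) m(2,1)] m by (simp add: arcs_on_def)
qed

lemma lift_relabel:
  assumes "finite V" "A \<subseteq> arcs_on V" shows "lift_arcs V ` relabel V A = A"
proof (intro equalityI subsetI)
  fix e assume e: "e \<in> A"
  obtain u w where uw: "e = (u, w)" by (cases e)
  then have "u \<in> V" "w \<in> V" using e assms by (auto simp: arcs_on_def)
  moreover have "V = nth_vertex V ` {1..card V}"
    using nth_vertex_bij[OF assms(1)] by (simp add: bij_betw_def)
  ultimately obtain j i where "j \<in> {1..card V}" "i \<in> {1..card V}" "u = nth_vertex V j" "w = nth_vertex V i"
    by (metis (no_types, lifting) imageE)
  then have "(j, i) \<in> relabel V A" "e = lift_arcs V (j, i)" using e uw by (auto simp: relabel_def)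
  then show "e \<in> lift_arcs V ` relabel V A" by blast
qed (auto simp: relabel_def)

lemma relabel_arcs_on: "finite V \<Longrightarrow> relabel V (arcs_on V) = arcs_on {1..card V}"
proof (intro equalityI relabel_subset order_refl; clarify?)
  fix j i assume V: "finite V" and e: "(j, i) \<in> arcs_on {1..card V}"
  then have m: "j \<in> {1..card V}" "i \<in> {1..card V}" "i < j" by (auto simp: arcs_on_def)
  moreover have "nth_vertex V ` {1..card V} = V"
    using nth_vertex_bij[OF V] by (simp add: bij_betw_def)
  ultimately show "(j, i) \<in> relabel V (arcs_on V)"
    using nth_vertex_less_iff[OF V m(2,1)] by (auto simp: relabel_def arcs_on_def)
qed

lemma relabel_eq_iff:
  assumes V: "finite V" and "A \<subseteq> arcs_on V" "S \<subseteq> arcs_on {1..card V}"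
  shows "relabel V A = S \<longleftrightarrow> A = lift_arcs V ` S"
  using inj_on_image_eq_iff[OF inj_lift_arcs[OF V] relabel_subset[OF V assms(2)] assms(3)]
  by (simp add: lift_relabel[OF V assms(2)])

lemma card_relabel:
  assumes V: "finite V" and A: "A \<subseteq> arcs_on V" shows "card (relabel V A) = card A"
  using card_image[OF inj_on_subset[OF inj_lift_arcs[OF V] relabel_subset[OF V A]]]
  by (simp add: lift_relabel[OF V A])

lemma out_degrees_eq:
  assumes val: "valid_graph n g"
  shows "out_degrees g = map (out_deg (relabel (vertices g) (parcs (orient g)))) [1..<Suc (card (vertices g))]"
proof -
  define V where "V = vertices g"
  define A where "A = parcs (orient g)"
  have V: "finite V" using val finite_subset[of V "{1..n}"] by (simp add: V_def valid_graph_def)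
  have A: "A \<subseteq> arcs_on V" using parcs_orient_subset[OF val] by (simp add: A_def V_def)
  have "out_degree (with_proj (orient g)) (nth_vertex V i) = out_deg (relabel V A) i"
    if i: "i \<in> {1..card V}" for i
  proof -
    have inj: "nth_vertex V j = nth_vertex V i \<longleftrightarrow> j = i" if "j \<in> {1..card V}" for j
      using nth_vertex_bij[OF V] that i by (auto simp: bij_betw_def inj_on_eq_iff)
    have "{e \<in> A. fst e = nth_vertex V i} = lift_arcs V ` {e \<in> relabel V A. fst e = i}"
    proof -
      have "{e \<in> lift_arcs V ` relabel V A. fst e = nth_vertex V i} = lift_arcs V ` {e \<in> relabel V A. fst e = i}"
        using inj by (auto simp: relabel_def)
      then show ?thesis by (simp only: lift_relabel[OF V A])
    qed
    moreover have "inj_on (lift_arcs V) {e \<in> relabel V A. fst e = i}"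
      using inj_lift_arcs[OF V] by (rule inj_on_subset) (use relabel_subset[OF V A] in auto)
    ultimately show ?thesis
      by (simp add: out_degree_def out_arcs_def out_deg_def card_image flip: A_def)
  qed
  then show ?thesis by (auto simp: out_degrees_def simp flip: V_def A_def simp del: upt_Suc)
qed

text \<open>Given the vertex history, an arc probability depends only on the tail of the arc, so the law of
  the relabelled graph charges all arc sets with the same out-degrees equally.\<close>

lemma relabelled_law_degree_class:
  fixes n :: nat and \<epsilon> :: real
  assumes \<beta>: "0 < \<beta>" and S: "S \<in> degree_class N d" and T: "T \<in> degree_class N d"
  defines "P \<equiv> map_pmf (\<lambda>gs. (card (vertices (last gs)), parcs (orient_relabelled (last gs))))
    (drgvr_history \<beta> \<epsilon> n)"
  shows "pmf P (N, S) = pmf P (N, T)"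
proof -
  obtain H where H: "\<forall>h\<in>set_pmf H. length h = Suc n \<and> last h \<subseteq> {1..n}"
    and law: "map_pmf arc_state (drgvr_history \<beta> \<epsilon> n)
      = bind_pmf H (\<lambda>h. map_pmf (Pair h) (random_subset (arcs_on (last h)) (arc_prob \<beta> h)))"
    using arc_state_law[OF \<beta>] by blast
  have "P = map_pmf (\<lambda>(h, A). (card (last h), relabel (last h) A)) (map_pmf arc_state (drgvr_history \<beta> \<epsilon> n))"
    unfolding P_def pmf.map_comp using drgvr_history_last_valid(1)
    by (intro map_pmf_cong refl) (auto simp: arc_state_def last_map orient_relabelled_eq)
  also have "\<dots> = bind_pmf H (\<lambda>h. map_pmf (\<lambda>A. (card (last h), relabel (last h) A))
      (random_subset (arcs_on (last h)) (arc_prob \<beta> h)))"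
    unfolding law by (simp add: map_bind_pmf pmf.map_comp o_def)
  finally have P: "P = bind_pmf H (\<lambda>h. map_pmf (\<lambda>A. (card (last h), relabel (last h) A))
      (random_subset (arcs_on (last h)) (arc_prob \<beta> h)))" .
  \<comment> \<open>The history is averaged out. The common mass of \<open>S\<close> and
    \<open>T\<close> may vary with the history, but equality for each history passes to the
    mixture.\<close>
  show ?thesis unfolding P pmf_bind
  proof (intro integral_cong_AE)
    show "AE h in measure_pmf H.
        pmf (map_pmf (\<lambda>A. (card (last h), relabel (last h) A)) (random_subset (arcs_on (last h)) (arc_prob \<beta> h))) (N, S)
      = pmf (map_pmf (\<lambda>A. (card (last h), relabel (last h) A)) (random_subset (arcs_on (last h)) (arc_prob \<beta> h))) (N, T)"
      unfolding AE_measure_pmf_iff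
    proof
      fix h assume h: "h \<in> set_pmf H"
      define V where "V = last h"
      have V: "finite V" using H h finite_subset[of V "{1..n}"] by (simp add: V_def)
      let ?R = "random_subset (arcs_on V) (arc_prob \<beta> h)"
      let ?R' = "map_pmf (\<lambda>A. (card V, relabel V A)) ?R"
      show "pmf (map_pmf (\<lambda>A. (card (last h), relabel (last h) A)) (random_subset (arcs_on (last h)) (arc_prob \<beta> h))) (N, S)
        = pmf (map_pmf (\<lambda>A. (card (last h), relabel (last h) A)) (random_subset (arcs_on (last h)) (arc_prob \<beta> h))) (N, T)"
        unfolding V_def[symmetric]
      proof (cases "card V = N")
        case False
        then have "(N, X) \<notin> set_pmf ?R'" for X by auto
        then have "pmf ?R' (N, X) = 0" for X by (meson set_pmf_iff)
        then show "pmf ?R' (N, S) = pmf ?R' (N, T)" by simp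
      next
        case True
        \<comment> \<open>After relabelling, the probability of an arc is a function
          \<open>q\<close> of its tail alone, as \<open>wt_fst_cong\<close> requires.\<close>
        define q where "q j = min (\<beta> / real (card (h ! (nth_vertex V j - 1)))) 1" for j
        have q: "arc_prob \<beta> h \<circ> lift_arcs V = (\<lambda>e. q (fst e))"
          by (auto simp: fun_eq_iff arc_prob_def q_def)
        have lift: "arcs_on V = lift_arcs V ` arcs_on {1..card V}"
          using lift_relabel[OF V order_refl] by (simp add: relabel_arcs_on[OF V])
        have "pmf ?R' (N, X) = wt (\<lambda>e. q (fst e)) (\<lambda>e. 1 - q (fst e)) (arcs_on {1..N}) X"
          if X: "X \<in> degree_class N d" for X
        proof -
          have sub: "X \<subseteq> arcs_on {1..card V}" using X True by (simp add: degree_class_def)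
          have "pmf ?R' (N, X) = pmf ?R (lift_arcs V ` X)"
          proof (rule pmf_map_unique)
            fix A assume "A \<in> set_pmf ?R"
            then have "A \<subseteq> arcs_on V" using set_random_subset[OF finite_arcs_on[OF V]] by blast
            then show "(card V, relabel V A) = (N, X) \<longleftrightarrow> A = lift_arcs V ` X"
              using relabel_eq_iff[OF V _ sub] True by simp
          qed
          also have "\<dots> = wt (arc_prob \<beta> h) (\<lambda>e. 1 - arc_prob \<beta> h e) (arcs_on V) (lift_arcs V ` X)"
            using sub \<beta> by (subst pmf_random_subset) (auto simp: finite_arcs_on V arc_prob_bounds lift)
          also have "\<dots> = wt (arc_prob \<beta> h \<circ> lift_arcs V) ((\<lambda>e. 1 - arc_prob \<beta> h e) \<circ> lift_arcs V)
              (arcs_on {1..card V}) X"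
            unfolding lift by (rule wt_image[OF inj_lift_arcs[OF V] sub])
          also have "(\<lambda>e. 1 - arc_prob \<beta> h e) \<circ> lift_arcs V = (\<lambda>e. 1 - (arc_prob \<beta> h \<circ> lift_arcs V) e)"
            by (simp add: o_def)
          finally show ?thesis unfolding q True .
        qed
        then show "pmf ?R' (N, S) = pmf ?R' (N, T)"
          using S T wt_fst_cong[OF S T, of q "\<lambda>j. 1 - q j"] by simp
      qed
    qed
  qed auto
qed

text \<open>An atom of the conditioning variable may contain many vertex histories. This does no
  harm, because the relabelled arcs are uniform on the degree class under the mixture as
  well.\<close>

lemma tail_given_out_degrees:
  assumes \<beta>: "0 < \<beta>" and f: "digraph_lipschitz L f" and "0 \<le> L" and t: "0 \<le> t"
    and gs: "gs \<in> set_pmf (drgvr_history \<beta> \<epsilon> n)"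
  defines "x \<equiv> \<lambda>gs :: ugraph list. (card (vertices (last gs)), out_degrees (last gs))"
    and "y \<equiv> \<lambda>gs. f (orient_relabelled (last gs))"
  shows "measure_pmf.prob (drgvr_history \<beta> \<epsilon> n) {gs'. x gs' = x gs \<and> t \<le> \<bar>y gs'
          - measure_pmf.expectation (drgvr_history \<beta> \<epsilon> n) (\<lambda>gs'. indicator {gs'. x gs' = x gs} gs' * y gs')
            / measure_pmf.prob (drgvr_history \<beta> \<epsilon> n) {gs'. x gs' = x gs}\<bar>}
        \<le> gauss_tail t (8 * real (card (edges (last gs))) * L\<^sup>2)
          * measure_pmf.prob (drgvr_history \<beta> \<epsilon> n) {gs'. x gs' = x gs}"
proof -
  let ?p = "drgvr_history \<beta> \<epsilon> n"
  define N where "N = card (vertices (last gs))"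
  define z where "z gs = relabel (vertices (last gs)) (parcs (orient (last gs)))" for gs :: "ugraph list"
  define d where "d = out_deg (z gs)"
  define P where "P = map_pmf (\<lambda>gs. (card (vertices (last gs)), z gs)) ?p"
  have fin: "finite (vertices (last k))" if "k \<in> set_pmf ?p" for k
    using drgvr_history_last_valid(2)[OF that] finite_subset[of _ "{1..n}"]
    by (auto simp: valid_graph_def)
  have arcs: "parcs (orient (last k)) \<subseteq> arcs_on (vertices (last k))" if "k \<in> set_pmf ?p" for k
    by (rule parcs_orient_subset[OF drgvr_history_last_valid(2)[OF that]])
  have zsub: "z k \<subseteq> arcs_on {1..card (vertices (last k))}" if "k \<in> set_pmf ?p" for k
    unfolding z_def by (rule relabel_subset[OF fin[OF that] arcs[OF that]])
  have x_iff: "x k = x gs \<longleftrightarrow> card (vertices (last k)) = N \<and> z k \<in> degree_class N d"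
    if k: "k \<in> set_pmf ?p" for k
  proof -
    have "x k = (card (vertices (last k)), map (out_deg (z k)) [1..<Suc (card (vertices (last k)))])"
      if "k \<in> set_pmf ?p" for k
      unfolding x_def z_def using out_degrees_eq[OF drgvr_history_last_valid(2)[OF that]] by simp
    from this[OF k] this[OF gs] show ?thesis
      using zsub[OF k] by (auto simp: N_def d_def degree_class_def simp del: upt_Suc)
  qed
  have zgs: "z gs \<in> degree_class N d" using zsub[OF gs] by (simp add: degree_class_def d_def N_def)
  have m: "(\<Sum>j=1..N. d j) = card (edges (last gs))"
    using sum_out_deg[OF zsub[OF gs]] card_relabel[OF fin[OF gs] arcs[OF gs]]
      card_parcs_orient[OF drgvr_history_last_valid(2)[OF gs]]
    by (simp add: d_def N_def z_def)
  \<comment> \<open>The common mass is named through \<open>z gs\<close>, the member of the class at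
    hand; it serves as the factor \<open>K\<close>.\<close>
  have unif: "pmf P (N, S) = pmf P (N, z gs)" if "S \<in> degree_class N d" for S
    using relabelled_law_degree_class[OF \<beta> that zgs] by (simp add: P_def z_def orient_relabelled_eq)
  have "measure_pmf.prob ?p {gs'. x gs' = x gs \<and> t \<le> \<bar>y gs'
          - measure_pmf.expectation ?p (\<lambda>gs'. indicator {gs'. x gs' = x gs} gs' * y gs')
            / measure_pmf.prob ?p {gs'. x gs' = x gs}\<bar>}
        \<le> gauss_tail t (4 * (real (\<Sum>j=1..N. d j) * (2 * L)\<^sup>2 / 8)) * measure_pmf.prob ?p {gs'. x gs' = x gs}"
  proof (rule tail_from_weights[where \<B> = "degree_class N d" and W = "\<lambda>_. 1" and K = "pmf P (N, z gs)"
        and z = z and g = "\<lambda>S. f \<lparr>pverts = {1..N}, parcs = S\<rparr>" and c = "2 * L"])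
    show "measure_pmf.expectation ?p (\<lambda>gs'. indicator {gs'. x gs' = x gs} gs' * \<psi> (z gs'))
      = pmf P (N, z gs) * (\<Sum>S\<in>degree_class N d. 1 * \<psi> S)" for \<psi>
    proof -
      define \<phi> where "\<phi> = (\<lambda>(N', S). if N' = N \<and> S \<in> degree_class N d then \<psi> S else 0)"
      have "measure_pmf.expectation ?p (\<lambda>gs'. indicator {gs'. x gs' = x gs} gs' * \<psi> (z gs'))
        = measure_pmf.expectation ?p (\<lambda>gs. \<phi> (card (vertices (last gs)), z gs))"
        by (intro integral_cong_AE) (auto simp: AE_measure_pmf_iff x_iff indicator_def \<phi>_def)
      also have "\<dots> = measure_pmf.expectation P \<phi>" by (simp add: P_def)
      also have "\<dots> = (\<Sum>a\<in>Pair N ` degree_class N d. \<phi> a * pmf P a)"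
        by (rule integral_measure_pmf_real) (auto simp: finite_degree_class \<phi>_def split: if_splits)
      also have "\<dots> = (\<Sum>S\<in>degree_class N d. \<psi> S * pmf P (N, z gs))"
        by (subst sum.reindex) (auto simp: inj_on_def \<phi>_def unif intro!: sum.cong)
      also have "\<dots> = (\<Sum>S\<in>degree_class N d. \<psi> S) * pmf P (N, z gs)"
        by (rule sum_distrib_right[symmetric])
      finally show ?thesis by (simp add: mult.commute)
    qed
    show "y k = f \<lparr>pverts = {1..N}, parcs = z k\<rparr>" if "k \<in> set_pmf ?p" "x k = x gs" for k
      using x_iff that by (simp add: y_def z_def orient_relabelled_eq)
    show "swap_concentrated (2 * L) (real (\<Sum>j=1..N. d j) * (2 * L)\<^sup>2 / 8) (degree_class N d) (\<lambda>_. 1)"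
      using \<open>0 \<le> L\<close> by (intro swap_concentrated_degree_class) simp
    show "swap_lipschitz (2 * L) (degree_class N d) (\<lambda>S. f \<lparr>pverts = {1..N}, parcs = S\<rparr>)"
      by (rule swap_lipschitz_subset[OF swap_lipschitz_digraph[OF f]]) (auto simp: degree_class_def)
  qed (use t in \<open>auto simp: finite_degree_class simp del: of_nat_sum\<close>)
  also have "\<dots> \<le> gauss_tail t (8 * real (\<Sum>j=1..N. d j) * L\<^sup>2) * measure_pmf.prob ?p {gs'. x gs' = x gs}"
    by (intro mult_right_mono gauss_tail_swap) simp
  finally show ?thesis unfolding m .
qed

theorem theorem1p12:
  fixes M :: "'w measure" and G :: "nat \<Rightarrow> 'w \<Rightarrow> ugraph"
    and \<beta> \<epsilon> t :: real and n L :: nat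
    and f :: "nat pair_pre_digraph \<Rightarrow> real"
  assumes "\<beta> > 0" and "0 < \<epsilon>" and "\<epsilon> \<le> 1/2"
    and "is_drgvr M \<beta> \<epsilon> G"
    and "digraph_lipschitz (real L) f"
    and "t \<ge> 0"
  shows
    "(let D = (\<lambda>\<omega>. orient_relabelled (G n \<omega>));
          X = (\<lambda>\<omega>. (card (vertices (G n \<omega>)), out_degrees (G n \<omega>)))
      in AE \<omega> in M.
           cond_prob_given M X
             {\<omega>' \<in> space M. \<bar>f (D \<omega>') - cond_exp_given M X (\<lambda>\<omega>. f (D \<omega>)) \<omega>'\<bar> \<ge> t} \<omega>
           \<le> gauss_tail t (8 * real (card (edges (G n \<omega>))) * (real L)\<^sup>2))
   \<and> (let D = (\<lambda>\<omega>. orient (G n \<omega>));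
          X = (\<lambda>\<omega>. (map (\<lambda>i. vertices (G i \<omega>)) [1..<Suc n], card (edges (G n \<omega>))))
      in AE \<omega> in M.
           cond_prob_given M X
             {\<omega>' \<in> space M. \<bar>f (D \<omega>') - cond_exp_given M X (\<lambda>\<omega>. f (D \<omega>)) \<omega>'\<bar> \<ge> t} \<omega>
           \<le> gauss_tail t (8 * real (card (edges (G n \<omega>))) * (real L)\<^sup>2))"
proof -
  define H where "H \<omega> = map (\<lambda>k. G k \<omega>) [0..<Suc n]" for \<omega>
  have M: "prob_space M" and H: "H \<in> measurable M (count_space UNIV)"
    and law: "distr M (count_space UNIV) H = measure_pmf (drgvr_history \<beta> \<epsilon> n)"
    using assms(4) by (auto simp: is_drgvr_def H_def[abs_def])
  have last: "last (H \<omega>) = G n \<omega>" for \<omega> by (simp add: H_def)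
  \<comment> \<open>Dropping the initial graph leaves the vertex sets from time 1 on, matching the
    conditioning variable of the second part.\<close>
  have tl: "map vertices (tl (H \<omega>)) = map (\<lambda>i. vertices (G i \<omega>)) [1..<Suc n]" for \<omega>
    unfolding H_def by (simp add: map_tl[symmetric] tl_upt o_def del: upt_Suc)
  note bridge = conditional_tail_from_pmf[OF M H law finite_drgvr_history, where t = t
      and b = "\<lambda>gs. gauss_tail t (8 * real (card (edges (last gs))) * (real L)\<^sup>2)"]
  note args = \<open>\<beta> > 0\<close> \<open>digraph_lipschitz (real L) f\<close> of_nat_0_le_iff \<open>t \<ge> 0\<close>
  show ?thesis
    unfolding Let_def
    using bridge[OF tail_given_out_degrees[OF args]] bridge[OF tail_given_vertex_history[OF args]]
    unfolding last tl by blast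
qed

end
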